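(* Let $(M,g)$ be a real analytic Riemannian manifold of dimension $n\ge2$, let $f:M\to\mathbb R$ be a real analytic function attaining its maximum $f_{\max}$, with $\mathrm{MAX}(f)=\{x\in M:f(x)=f_{\max}\}$ disjoint from $\partial M$ (if $M$ has boundary), and let $\Sigma$ be the top stratum of $\mathrm{MAX}(f)$. If $p\in\overline\Sigma$ and $|\nabla^2f|(p)\neq0$, then $p\in\Sigma$.
   Context: **Top stratum.** By Łojasiewicz's structure theorem $\mathrm{MAX}(f)$ decomposes into real analytic submanifolds of dimensions $0,\dots,n-1$; the top stratum is the $(n-1)$-dimensional part: the set of points $p\in\mathrm{MAX}(f)$ having an open neighborhood $\Omega$ such that $\Omega\cap\mathrm{MAX}(f)$ is an embedded real analytic hypersurface of $\Omega$. $\overline\Sigma$ is the closure of $\Sigma$ in $M$, and $\nabla^2f$ is the Hessian of $f$ with respect to $g$. *)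

theory Defs
  imports "HOL-Analysis.Analysis"
begin

(* Local expansion into a power series over multi-indices; has_sum on the reals means absolute
   convergence. At a point x0 not interior to S (this occurs for half-space charts) the series
   still has to converge on a full ball around x0, so that it defines a local analytic extension. *)
definition real_analytic_on :: "(real^'n \<Rightarrow> real) \<Rightarrow> (real^'n) set \<Rightarrow> bool"
    (infixl "real'_analytic'_on" 50) where
  "h real_analytic_on S \<longleftrightarrow>
     (\<forall>x0\<in>S. \<exists>(c :: ('n \<Rightarrow> nat) \<Rightarrow> real) r. r > 0 \<and>
        (\<forall>x\<in>ball x0 r. (\<lambda>\<alpha>. c \<alpha> * (\<Prod>i\<in>UNIV. (x $ i - x0 $ i) ^ \<alpha> i)) summable_on UNIV) \<and>
        (\<forall>x\<in>ball x0 r \<inter> S. ((\<lambda>\<alpha>. c \<alpha> * (\<Prod>i\<in>UNIV. (x $ i - x0 $ i) ^ \<alpha> i)) has_sum h x) UNIV))"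


(* A chart consists of a domain U and a coordinate map whose values outside U are irrelevant. *)
type_synonym ('a, 'n) chart = "'a set \<times> ('a \<Rightarrow> (real, 'n) vec)"

definition half_space :: "'n::finite \<Rightarrow> (real^'n) set" where
  "half_space k = {x. 0 \<le> x $ k}"

abbreviation chart_range :: "('a, 'n::finite) chart \<Rightarrow> (real^'n) set" where
  "chart_range c \<equiv> snd c ` fst c"

abbreviation chart_inv :: "('a, 'n::finite) chart \<Rightarrow> real^'n \<Rightarrow> 'a" where
  "chart_inv c \<equiv> inv_into (fst c) (snd c)"

definition is_chart :: "('a::topological_space, 'n::finite) chart \<Rightarrow> bool" where
  "is_chart c \<longleftrightarrow>
     open (fst c) \<and> inj_on (snd c) (fst c) \<and>
     homeomorphism (fst c) (chart_range c) (snd c) (chart_inv c) \<and>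
     (open (chart_range c) \<or> (\<exists>k. openin (top_of_set (half_space k)) (chart_range c)))"

definition transition :: "('a, 'n::finite) chart \<Rightarrow> ('a, 'n) chart \<Rightarrow> real^'n \<Rightarrow> real^'n" where
  "transition c d = snd d \<circ> chart_inv c"

definition analytic_compatible :: "('a, 'n::finite) chart \<Rightarrow> ('a, 'n) chart \<Rightarrow> bool" where
  "analytic_compatible c d \<longleftrightarrow>
     (\<forall>i. (\<lambda>x. transition c d x $ i) real_analytic_on snd c ` (fst c \<inter> fst d)) \<and>
     (\<forall>i. (\<lambda>x. transition d c x $ i) real_analytic_on snd d ` (fst c \<inter> fst d))"

(* The manifold is the whole type, of dimension CARD('n), possibly with boundary. *)
definition real_analytic_atlas ::
    "('a::{t2_space, second_countable_topology}, 'n::finite) chart set \<Rightarrow> bool" where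
  "real_analytic_atlas A \<longleftrightarrow>
     (\<Union>c\<in>A. fst c) = UNIV \<and> (\<forall>c\<in>A. is_chart c) \<and> (\<forall>c\<in>A. \<forall>d\<in>A. analytic_compatible c d)"

definition max_atlas :: "('a::topological_space, 'n::finite) chart set \<Rightarrow> ('a, 'n) chart set" where
  "max_atlas A = {c. is_chart c \<and> (\<forall>d\<in>A. analytic_compatible c d)}"

definition manifold_boundary :: "('a::topological_space, 'n::finite) chart set \<Rightarrow> 'a set" where
  "manifold_boundary A =
     {p. \<exists>c\<in>A. \<exists>k. p \<in> fst c \<and> openin (top_of_set (half_space k)) (chart_range c) \<and> snd c p $ k = 0}"

definition real_analytic_function :: "('a, 'n::finite) chart set \<Rightarrow> ('a \<Rightarrow> real) \<Rightarrow> bool" where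
  "real_analytic_function A f \<longleftrightarrow> (\<forall>c\<in>A. (f \<circ> chart_inv c) real_analytic_on chart_range c)"


(* A Riemannian metric is given by its component matrices: g c p $ i $ j is the value of the metric
   at p on the i-th and j-th coordinate vector fields of the chart c. The last clause is the
   transformation law of a covariant 2-tensor. Derivatives are taken within the coordinate domain,
   which makes them one-sided at boundary points and is immaterial at interior points. *)
definition real_analytic_metric ::
    "('a, 'n::finite) chart set \<Rightarrow> (('a, 'n) chart \<Rightarrow> 'a \<Rightarrow> real^'n^'n) \<Rightarrow> bool" where
  "real_analytic_metric A g \<longleftrightarrow>
     (\<forall>c\<in>A. \<forall>i j. (\<lambda>x. g c (chart_inv c x) $ i $ j) real_analytic_on chart_range c) \<and>
     (\<forall>c\<in>A. \<forall>p\<in>fst c. transpose (g c p) = g c p \<and> (\<forall>v. v \<noteq> 0 \<longrightarrow> v \<bullet> (g c p *v v) > 0)) \<and>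
     (\<forall>c\<in>A. \<forall>d\<in>A. \<forall>p\<in>fst c \<inter> fst d.
        let J = jacobian (transition c d) (at (snd c p) within snd c ` (fst c \<inter> fst d))
        in g c p = transpose J ** g d p ** J)"

definition partial_deriv :: "(real^'n) set \<Rightarrow> 'n::finite \<Rightarrow> (real^'n \<Rightarrow> real) \<Rightarrow> real^'n \<Rightarrow> real" where
  "partial_deriv S i h x = frechet_derivative h (at x within S) (axis i 1)"

(* The symbol with upper index k and lower indices i, j, at the point with coordinates x. *)
definition christoffel ::
    "(('a, 'n) chart \<Rightarrow> 'a \<Rightarrow> real^'n^'n) \<Rightarrow> ('a, 'n::finite) chart \<Rightarrow> 'n \<Rightarrow> 'n \<Rightarrow> 'n \<Rightarrow> real^'n \<Rightarrow> real"
  where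
  "christoffel g c k i j x =
     (let G = \<lambda>a b y. g c (chart_inv c y) $ a $ b; D = partial_deriv (chart_range c)
      in 1/2 * (\<Sum>l\<in>UNIV. matrix_inv (g c (chart_inv c x)) $ k $ l *
                  (D i (G j l) x + D j (G i l) x - D l (G i j) x)))"

definition hessian ::
    "(('a, 'n) chart \<Rightarrow> 'a \<Rightarrow> real^'n^'n) \<Rightarrow> ('a \<Rightarrow> real) \<Rightarrow> ('a, 'n::finite) chart \<Rightarrow> 'a \<Rightarrow> real^'n^'n"
  where
  "hessian g f c p =
     (let F = f \<circ> chart_inv c; x = snd c p; D = partial_deriv (chart_range c)
      in \<chi> i j. D i (D j F) x - (\<Sum>k\<in>UNIV. christoffel g c k i j x * D k F x))"

(* The norm induced by the metric on covariant 2-tensors. It does not depend on the chart of the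
   atlas around p, so an arbitrary one is chosen. *)
definition hessian_norm ::
    "('a, 'n::finite) chart set \<Rightarrow> (('a, 'n) chart \<Rightarrow> 'a \<Rightarrow> real^'n^'n) \<Rightarrow> ('a \<Rightarrow> real) \<Rightarrow> 'a \<Rightarrow> real"
  where
  "hessian_norm A g f p =
     (let c = (SOME c. c \<in> A \<and> p \<in> fst c); H = hessian g f c p; Ginv = matrix_inv (g c p)
      in sqrt (\<Sum>i\<in>UNIV. \<Sum>j\<in>UNIV. \<Sum>k\<in>UNIV. \<Sum>l\<in>UNIV.
                 Ginv $ i $ k * Ginv $ j $ l * H $ i $ j * H $ k $ l))"


definition max_set :: "('a \<Rightarrow> real) \<Rightarrow> 'a set" where
  "max_set f = {x. f x = (SUP y. f y)}"

(* S is a codimension-one embedded analytic submanifold of the open set W, lying in the interior of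
   the manifold: every point of S has a chart of the maximal atlas, with image open in the full
   coordinate space, that maps S onto a coordinate hyperplane slice. *)
definition embedded_analytic_hypersurface ::
    "('a::topological_space, 'n::finite) chart set \<Rightarrow> 'a set \<Rightarrow> 'a set \<Rightarrow> bool" where
  "embedded_analytic_hypersurface A W S \<longleftrightarrow>
     S \<subseteq> W \<and>
     (\<forall>q\<in>S. \<exists>c\<in>max_atlas A. q \<in> fst c \<and> fst c \<subseteq> W \<and> open (chart_range c) \<and>
        (\<exists>k. snd c ` (fst c \<inter> S) = {x \<in> chart_range c. x $ k = 0}))"

definition top_stratum ::
    "('a::topological_space, 'n::finite) chart set \<Rightarrow> ('a \<Rightarrow> real) \<Rightarrow> 'a set" where
  "top_stratum A f =
     {p \<in> max_set f. \<exists>W. open W \<and> p \<in> W \<and> embedded_analytic_hypersurface A W (W \<inter> max_set f)}"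

end

theory Submission
  imports Defs
begin

text \<open>At a maximum \<open>p\<close> with \<open>\<nabla>\<^sup>2f \<noteq> 0\<close> the gradient vanishes, so in coordinates the second
  derivatives form a nonzero negative semidefinite symmetric matrix and some diagonal entry \<open>\<partial>\<^sub>k\<partial>\<^sub>kf(p)\<close> is
  nonzero. By the analytic implicit function theorem \<open>{\<partial>\<^sub>kf = 0}\<close> is near \<open>p\<close> the graph \<open>x\<^sub>k = \<phi>(x')\<close> of an
  analytic function, and it contains \<open>MAX(f)\<close>. Near a point of the top stratum close to \<open>p\<close> the two
  hypersurfaces have the same dimension, so by invariance of domain \<open>f\<close> is maximal on an open piece of
  the graph. By the identity theorem \<open>f\<close> is then maximal on the whole graph near \<open>p\<close>, so \<open>MAX(f)\<close> is the
  graph there.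

  Analyticity is handled through the weighted \<open>\<ell>\<^sup>1\<close> norms of the coefficients of a power series on a
  cube, for which sums, products and compositions obey the estimates of a Banach algebra.\<close>

section \<open>Absolutely convergent power series on cubes\<close>

text \<open>The point \<open>p\<close> is only a limit of stratum points, and the charts that
  exhibit \<open>MAX(f)\<close> as a hypersurface near those points may shrink as they approach
  \<open>p\<close>. What keeps a fixed size is the cube centred at \<open>p\<close> on which
  \<open>f\<close> and the implicit function expand. There \<open>f\<close> along the graph minus
  its maximum is a single power series, so vanishing on an arbitrarily small open piece spreads to a
  cube whose size does not depend on the stratum point chosen. A nonzero diagonal entry, rather than
  any nonzero entry, is wanted because one coordinate \<open>k\<close> then serves both as the
  derivative whose zeros contain the maxima and as the variable solved for. Membership in the
  stratum asks for a chart of the maximal atlas. The graph is therefore straightened by the shear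
  that subtracts its height from coordinate \<open>k\<close>; the inverse is again a shear, so
  analyticity in both directions follows from that of \<phi>.\<close>

definition monomial :: "real^'n \<Rightarrow> ('n::finite \<Rightarrow> nat) \<Rightarrow> real" where
  "monomial x \<alpha> = (\<Prod>i\<in>UNIV. x $ i ^ \<alpha> i)"

definition index_degree :: "('n::finite \<Rightarrow> nat) \<Rightarrow> nat" where
  "index_degree \<alpha> = (\<Sum>i\<in>UNIV. \<alpha> i)"

text \<open>On the closed sup-norm ball every monomial attains its largest modulus at the corner (r,
  ..., r), where it equals the weight \<open>r ^ index_degree \<alpha>\<close>. Absolute convergence
  at the corner thus controls the series on the whole cube.\<close>

definition cube :: "real \<Rightarrow> (real^'n) set" where
  "cube r = {x. \<forall>i. \<bar>x $ i\<bar> \<le> r}"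

text \<open>The infinite sum is 0 by default if the family is not summable, so a bound on it says
  something only together with the summability recorded in \<open>expansion\<close>.\<close>

definition series_norm :: "real \<Rightarrow> (('n::finite \<Rightarrow> nat) \<Rightarrow> real) \<Rightarrow> real" where
  "series_norm r c = (\<Sum>\<^sub>\<infinity>\<alpha>. \<bar>c \<alpha>\<bar> * r ^ index_degree \<alpha>)"

definition expansion ::
    "real \<Rightarrow> (('n::finite \<Rightarrow> nat) \<Rightarrow> real) \<Rightarrow> (real^'n \<Rightarrow> real) \<Rightarrow> bool" where
  "expansion r c h \<longleftrightarrow>
     (\<lambda>\<alpha>. \<bar>c \<alpha>\<bar> * r ^ index_degree \<alpha>) summable_on UNIV \<and>
     (\<forall>x\<in>cube r. ((\<lambda>\<alpha>. c \<alpha> * monomial x \<alpha>) has_sum h x) UNIV)"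

text \<open>The coefficients are hidden and \<open>B\<close> is only an upper bound for the norm, so
  that estimates can be chained without tracking coefficient formulas.\<close>

definition expands :: "real \<Rightarrow> real \<Rightarrow> (real^'n::finite \<Rightarrow> real) \<Rightarrow> bool" where
  "expands r B h \<longleftrightarrow> (\<exists>c. expansion r c h \<and> series_norm r c \<le> B)"

lemma cube_iff: "x \<in> cube r \<longleftrightarrow> (\<forall>i. \<bar>x $ i\<bar> \<le> r)"
  by (simp add: cube_def)

lemma abs_monomial_le: "x \<in> cube r \<Longrightarrow> \<bar>monomial x \<alpha>\<bar> \<le> r ^ index_degree \<alpha>"
  unfolding monomial_def index_degree_def cube_def power_sum abs_prod
  by (intro prod_mono) (auto simp: power_abs intro: power_mono)

lemma index_degree_upd: "index_degree (\<alpha>(i := Suc (\<alpha> i))) = Suc (index_degree \<alpha>)"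
proof -
  have "(\<Sum>j\<in>UNIV. (\<alpha>(i := Suc (\<alpha> i))) j) = (\<Sum>j\<in>UNIV. \<alpha> j + (if j = i then 1 else 0))"
    by (intro sum.cong) auto
  then show ?thesis by (simp add: index_degree_def sum.distrib)
qed

lemma monomial_upd: "monomial x (\<alpha>(i := Suc (\<alpha> i))) = x $ i * monomial x \<alpha>"
proof -
  have "(\<Prod>j\<in>UNIV. x $ j ^ (\<alpha>(i := Suc (\<alpha> i))) j)
      = (\<Prod>j\<in>UNIV. x $ j ^ \<alpha> j * (if j = i then x $ i else 1))"
    by (intro prod.cong) auto
  then show ?thesis by (simp add: monomial_def prod.distrib)
qed

lemma monomial_0: "monomial x (\<lambda>_. 0) = 1"
  by (simp add: monomial_def)

lemma index_degree_0: "index_degree (\<lambda>_. 0) = 0"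
  by (simp add: index_degree_def)

lemma index_degree_eq_0: "index_degree \<alpha> = 0 \<longleftrightarrow> \<alpha> = (\<lambda>_. 0)"
  by (auto simp: index_degree_def)

lemma monomial_at_0: "monomial 0 \<alpha> = (if \<alpha> = (\<lambda>_. 0) then 1 else 0)"
proof (cases "\<alpha> = (\<lambda>_. 0)")
  case False
  then obtain i where "\<alpha> i \<noteq> 0" by auto
  then show ?thesis using False by (auto simp: monomial_def intro!: prod_zero bexI[of _ i])
qed (simp add: monomial_0)

lemma summable_abs_imp_abs_summable:
  fixes f :: "'b \<Rightarrow> real"
  assumes "g summable_on A" "\<And>x. x \<in> A \<Longrightarrow> \<bar>f x\<bar> \<le> g x"
  shows "(\<lambda>x. norm (f x)) summable_on A"
  by (rule summable_on_comparison_test[OF assms(1)]) (use assms(2) in auto)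

lemma summable_on_abs_bound:
  fixes f :: "'b \<Rightarrow> real"
  assumes "g summable_on A" "\<And>x. x \<in> A \<Longrightarrow> \<bar>f x\<bar> \<le> g x"
  shows "f summable_on A"
  using summable_abs_imp_abs_summable[OF assms] by (rule abs_summable_summable)

lemma expansion_summable:
  assumes "(\<lambda>\<alpha>. \<bar>c \<alpha>\<bar> * r ^ index_degree \<alpha>) summable_on UNIV" "x \<in> cube r"
  shows "(\<lambda>\<alpha>. c \<alpha> * monomial x \<alpha>) summable_on UNIV"
  by (rule summable_on_abs_bound[OF assms(1)])
    (auto simp: abs_mult intro!: mult_left_mono abs_monomial_le assms(2))

lemma series_norm_nonneg: "r \<ge> 0 \<Longrightarrow> series_norm r c \<ge> 0"
  unfolding series_norm_def by (intro infsum_nonneg) auto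

lemma expands_nonneg: "expands r B h \<Longrightarrow> r \<ge> 0 \<Longrightarrow> B \<ge> 0"
  unfolding expands_def using series_norm_nonneg by (meson order_trans)

lemma expandsI:
  assumes "((\<lambda>\<alpha>. \<bar>c \<alpha>\<bar> * r ^ index_degree \<alpha>) has_sum N) UNIV" "N \<le> B"
    and "\<And>x. x \<in> cube r \<Longrightarrow> ((\<lambda>\<alpha>. c \<alpha> * monomial x \<alpha>) has_sum h x) UNIV"
  shows "expands r B h"
proof -
  have "expansion r c h" using assms has_sum_imp_summable[OF assms(1)] by (auto simp: expansion_def)
  moreover have "series_norm r c \<le> B" using assms(2) infsumI[OF assms(1)] by (simp add: series_norm_def)
  ultimately show ?thesis by (auto simp: expands_def)
qed

lemma expansion_cong:
  "expansion r c h \<Longrightarrow> (\<And>x. x \<in> cube r \<Longrightarrow> h x = h' x) \<Longrightarrow> expansion r c h'"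
  by (simp add: expansion_def)

lemma expands_mono: "expands r B h \<Longrightarrow> B \<le> B' \<Longrightarrow> expands r B' h"
  unfolding expands_def by fastforce

lemma expansion_bound:
  assumes "expansion r c h" "x \<in> cube r"
  shows "\<bar>h x\<bar> \<le> series_norm r c"
proof -
  have s: "(\<lambda>\<alpha>. \<bar>c \<alpha>\<bar> * r ^ index_degree \<alpha>) summable_on UNIV"
    and h: "((\<lambda>\<alpha>. c \<alpha> * monomial x \<alpha>) has_sum h x) UNIV"
    using assms by (auto simp: expansion_def)
  have b: "\<bar>c \<alpha> * monomial x \<alpha>\<bar> \<le> \<bar>c \<alpha>\<bar> * r ^ index_degree \<alpha>" for \<alpha>
    by (auto simp: abs_mult intro!: mult_left_mono abs_monomial_le assms(2))
  have a: "(\<lambda>\<alpha>. norm (c \<alpha> * monomial x \<alpha>)) summable_on UNIV"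
    by (rule summable_abs_imp_abs_summable[OF s b])
  have "\<bar>h x\<bar> \<le> (\<Sum>\<^sub>\<infinity>\<alpha>. \<bar>c \<alpha> * monomial x \<alpha>\<bar>)"
    using norm_infsum_bound[OF a] infsumI[OF h] by simp
  also have "\<dots> \<le> series_norm r c"
    unfolding series_norm_def by (intro infsum_mono s b) (use a in simp)
  finally show ?thesis .
qed

lemma expands_bound: "expands r B h \<Longrightarrow> x \<in> cube r \<Longrightarrow> \<bar>h x\<bar> \<le> B"
  unfolding expands_def using expansion_bound by fastforce

lemma expansion_at_0: "expansion r c h \<Longrightarrow> r \<ge> 0 \<Longrightarrow> c (\<lambda>_. 0) = h 0"
proof -
  assume "expansion r c h" "r \<ge> 0"
  then have "((\<lambda>\<alpha>. c \<alpha> * monomial 0 \<alpha>) has_sum h 0) UNIV"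
    by (auto simp: expansion_def cube_iff)
  moreover have "((\<lambda>\<alpha>. c \<alpha> * monomial 0 \<alpha>) has_sum c (\<lambda>_. 0)) UNIV"
    by (rule has_sum_finite_neutralI[of "{\<lambda>_. 0}"]) (auto simp: monomial_at_0)
  ultimately show ?thesis using has_sum_unique by blast
qed

text \<open>Completeness of the weighted space: the weighted coefficients are summable over pairs
  (index in \<open>J\<close>, multi-index), so both orders of summation agree and coefficients may
  be added termwise. Taking \<open>J\<close> to be \<open>bool\<close>, multi-indices or naturals
  yields sums, products and substitutions, and the limit of the fixed point iteration.\<close>

lemma expands_has_sum:
  assumes r: "r \<ge> 0" and h: "\<And>j. j \<in> J \<Longrightarrow> expands r (B j) (h j)"
    and B: "(B has_sum C) J"
    and H: "\<And>x. x \<in> cube r \<Longrightarrow> ((\<lambda>j. h j x) has_sum H x) J"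
  shows "expands r C H"
proof -
  obtain c where c: "\<And>j. j \<in> J \<Longrightarrow> expansion r (c j) (h j) \<and> series_norm r (c j) \<le> B j"
    using h unfolding expands_def by metis
  define w where "w = (\<lambda>(j, \<alpha>). \<bar>c j \<alpha>\<bar> * r ^ index_degree \<alpha>)"
  have w1: "((\<lambda>\<alpha>. w (j, \<alpha>)) has_sum series_norm r (c j)) UNIV" if "j \<in> J" for j
    using c[OF that] by (simp add: w_def expansion_def series_norm_def)
  have Bs: "B summable_on J" using B has_sum_imp_summable by blast
  have ns: "(\<lambda>j. series_norm r (c j)) summable_on J"
    by (rule summable_on_comparison_test[OF Bs]) (use c series_norm_nonneg[OF r] in auto)
  have ws: "w summable_on J \<times> UNIV"
    by (rule summable_on_SigmaI[OF w1 ns]) (use r in \<open>auto simp: w_def\<close>)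
  have wsum: "(w has_sum (\<Sum>\<^sub>\<infinity>j\<in>J. series_norm r (c j))) (J \<times> UNIV)"
    by (rule has_sum_SigmaI[OF w1 _ ws]) (use ns in auto)
  define W where "W = (\<Sum>\<^sub>\<infinity>j\<in>J. series_norm r (c j))"
  have WC: "W \<le> C"
    unfolding W_def infsumI[OF B, symmetric] by (intro infsum_mono ns Bs) (use c in auto)
  have wswap: "((\<lambda>(\<alpha>, j). w (j, \<alpha>)) has_sum W) (UNIV \<times> J)"
    using has_sum_swap[THEN iffD1, OF wsum] unfolding W_def by simp
  \<comment> \<open>\<open>M \<alpha>\<close> is the weighted sum of the moduli of the coefficients
    at \<alpha>; it dominates the weighted coefficient of the limit series, and its total is
    \<open>W \<le> C\<close>.\<close>
  define M where "M \<alpha> = (\<Sum>\<^sub>\<infinity>j\<in>J. w (j, \<alpha>))" for \<alpha>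
  have Msum: "((\<lambda>j. w (j, \<alpha>)) has_sum M \<alpha>) J" for \<alpha>
    unfolding M_def
    using summable_on_SigmaD1[of "\<lambda>\<alpha> j. w (j, \<alpha>)" UNIV "\<lambda>_. J" \<alpha>] has_sum_imp_summable[OF wswap]
    by simp
  have MW: "(M has_sum W) UNIV"
    by (rule has_sum_SigmaD[OF wswap]) (use Msum in auto)
  define d where "d \<alpha> = (\<Sum>\<^sub>\<infinity>j\<in>J. c j \<alpha>)" for \<alpha>
  have sc: "(\<lambda>j. norm (c j \<alpha> * r ^ index_degree \<alpha>)) summable_on J" for \<alpha>
    by (rule summable_abs_imp_abs_summable[OF has_sum_imp_summable[OF Msum]])
      (use r in \<open>auto simp: w_def abs_mult\<close>)
  have db: "\<bar>d \<alpha>\<bar> * r ^ index_degree \<alpha> \<le> M \<alpha>" for \<alpha>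
  proof -
    have "\<bar>\<Sum>\<^sub>\<infinity>j\<in>J. c j \<alpha> * r ^ index_degree \<alpha>\<bar> \<le> (\<Sum>\<^sub>\<infinity>j\<in>J. \<bar>c j \<alpha> * r ^ index_degree \<alpha>\<bar>)"
      using norm_infsum_bound[OF sc[of \<alpha>]] by simp
    also have "\<dots> = M \<alpha>" using r by (simp add: M_def w_def abs_mult)
    finally show ?thesis using r by (simp add: d_def infsum_cmult_left' abs_mult)
  qed
  have ds: "(\<lambda>\<alpha>. \<bar>d \<alpha>\<bar> * r ^ index_degree \<alpha>) summable_on UNIV"
    by (rule summable_on_comparison_test[OF has_sum_imp_summable[OF MW]]) (use db r in auto)
  have "series_norm r d \<le> W"
    unfolding series_norm_def infsumI[OF MW, symmetric]
    by (intro infsum_mono ds db has_sum_imp_summable[OF MW])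
  moreover have "((\<lambda>\<alpha>. d \<alpha> * monomial x \<alpha>) has_sum H x) UNIV" if x: "x \<in> cube r" for x
  proof -
    define t where "t = (\<lambda>(j, \<alpha>). c j \<alpha> * monomial x \<alpha>)"
    have ts: "t summable_on J \<times> UNIV"
      by (rule summable_on_abs_bound[OF ws])
        (auto simp: t_def w_def abs_mult intro!: mult_left_mono abs_monomial_le x)
    have "(t has_sum H x) (J \<times> UNIV)"
      by (rule has_sum_SigmaI[OF _ H[OF x] ts]) (use c x in \<open>auto simp: t_def expansion_def\<close>)
    from has_sum_swap[THEN iffD1, OF this]
    have tsw: "((\<lambda>(\<alpha>, j). t (j, \<alpha>)) has_sum H x) (UNIV \<times> J)" by simp
    have "((\<lambda>j. t (j, \<alpha>)) has_sum d \<alpha> * monomial x \<alpha>) J" for \<alpha>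
    proof -
      have "(\<lambda>j. t (j, \<alpha>)) summable_on J"
        using summable_on_SigmaD1[of "\<lambda>\<alpha> j. t (j, \<alpha>)" UNIV "\<lambda>_. J" \<alpha>] has_sum_imp_summable[OF tsw]
        by simp
      moreover have "infsum (\<lambda>j. t (j, \<alpha>)) J = d \<alpha> * monomial x \<alpha>"
        by (simp add: t_def d_def infsum_cmult_left')
      ultimately show ?thesis by (metis has_sum_infsum)
    qed
    then show ?thesis by (intro has_sum_SigmaD[OF tsw]) auto
  qed
  ultimately have "expansion r d H" "series_norm r d \<le> C" using ds WC by (auto simp: expansion_def)
  then show ?thesis by (auto simp: expands_def)
qed

section \<open>The algebra of expansions: sums, products, substitution\<close>

lemma expands_scale:
  assumes "expands r B h"
  shows "expands r (\<bar>k\<bar> * B) (\<lambda>x. k * h x)"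
proof -
  obtain c where c: "expansion r c h" "series_norm r c \<le> B"
    using assms by (auto simp: expands_def)
  then have "expansion r (\<lambda>\<alpha>. k * c \<alpha>) (\<lambda>x. k * h x)"
    by (auto simp: expansion_def abs_mult mult.assoc intro!: has_sum_cmult_right summable_on_cmult_right)
  moreover have "series_norm r (\<lambda>\<alpha>. k * c \<alpha>) = \<bar>k\<bar> * series_norm r c"
    by (simp add: series_norm_def abs_mult mult.assoc infsum_cmult_right')
  moreover have "\<bar>k\<bar> * series_norm r c \<le> \<bar>k\<bar> * B" using c(2) by (simp add: mult_left_mono)
  ultimately show ?thesis by (auto simp: expands_def)
qed

lemma expands_const: "expands r \<bar>k\<bar> (\<lambda>_::real^'n. k)"
proof -
  define c where "c = (\<lambda>\<alpha>::'n \<Rightarrow> nat. if \<alpha> = (\<lambda>_. 0) then k else 0)"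
  have "((\<lambda>\<alpha>. \<bar>c \<alpha>\<bar> * r ^ index_degree \<alpha>) has_sum \<bar>k\<bar>) UNIV"
    by (rule has_sum_finite_neutralI[of "{\<lambda>_. 0}"]) (auto simp: c_def index_degree_0)
  moreover have "((\<lambda>\<alpha>. c \<alpha> * monomial x \<alpha>) has_sum k) UNIV" for x
    by (rule has_sum_finite_neutralI[of "{\<lambda>_. 0}"]) (auto simp: c_def monomial_0)
  ultimately show ?thesis by (intro expandsI[OF _ order_refl])
qed

lemma inj_raise_index: "inj (\<lambda>\<alpha>::'n \<Rightarrow> nat. \<alpha>(i := Suc (\<alpha> i)))"
proof (rule injI)
  fix \<alpha> \<beta> :: "'n \<Rightarrow> nat"
  assume e: "\<alpha>(i := Suc (\<alpha> i)) = \<beta>(i := Suc (\<beta> i))"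
  show "\<alpha> = \<beta>"
  proof
    fix j show "\<alpha> j = \<beta> j" using fun_cong[OF e, of j] by (cases "j = i") auto
  qed
qed

lemma range_raise_index: "range (\<lambda>\<alpha>::'n \<Rightarrow> nat. \<alpha>(i := Suc (\<alpha> i))) = {\<alpha>. \<alpha> i \<noteq> 0}"
proof (intro equalityI subsetI)
  fix \<alpha> :: "'n \<Rightarrow> nat" assume "\<alpha> \<in> {\<alpha>. \<alpha> i \<noteq> 0}"
  then have "\<alpha> = (\<alpha>(i := \<alpha> i - 1))(i := Suc ((\<alpha>(i := \<alpha> i - 1)) i))" by auto
  then show "\<alpha> \<in> range (\<lambda>\<alpha>. \<alpha>(i := Suc (\<alpha> i)))" by blast
qed auto

text \<open>Raising the exponent of coordinate \<open>i\<close> is a bijection onto the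
  multi-indices with positive \<open>i\<close>-th entry. This one reindexing serves both
  multiplication by a coordinate and differentiation.\<close>

lemma has_sum_raise_index:
  fixes f :: "('n \<Rightarrow> nat) \<Rightarrow> real"
  assumes "\<And>\<alpha>. \<alpha> i = 0 \<Longrightarrow> f \<alpha> = 0"
  shows "((\<lambda>\<alpha>. f (\<alpha>(i := Suc (\<alpha> i)))) has_sum s) UNIV \<longleftrightarrow> (f has_sum s) UNIV"
proof -
  have "((\<lambda>\<alpha>. f (\<alpha>(i := Suc (\<alpha> i)))) has_sum s) UNIV
      \<longleftrightarrow> (f has_sum s) (range (\<lambda>\<alpha>. \<alpha>(i := Suc (\<alpha> i))))"
    using has_sum_reindex[OF inj_raise_index[of i], of f] by (simp add: o_def)
  also have "\<dots> \<longleftrightarrow> (f has_sum s) UNIV"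
    unfolding range_raise_index by (rule has_sum_cong_neutral) (use assms in auto)
  finally show ?thesis .
qed

lemma expands_coord_mult:
  assumes "expands r B h" "r \<ge> 0"
  shows "expands r (r * B) (\<lambda>x. x $ i * h x)"
proof -
  obtain c where c: "expansion r c h" "series_norm r c \<le> B"
    using assms by (auto simp: expands_def)
  define d where "d = (\<lambda>\<alpha>. if \<alpha> i = 0 then 0 else c (\<alpha>(i := \<alpha> i - 1)))"
  have d: "d (\<alpha>(i := Suc (\<alpha> i))) = c \<alpha>" for \<alpha> by (simp add: d_def)
  have "((\<lambda>\<alpha>. \<bar>c \<alpha>\<bar> * r ^ index_degree \<alpha>) has_sum series_norm r c) UNIV"
    using c by (simp add: expansion_def series_norm_def)
  then have "((\<lambda>\<alpha>. r * (\<bar>c \<alpha>\<bar> * r ^ index_degree \<alpha>)) has_sum r * series_norm r c) UNIV"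
    by (rule has_sum_cmult_right)
  then have "((\<lambda>\<alpha>. \<bar>d (\<alpha>(i := Suc (\<alpha> i)))\<bar> * r ^ index_degree (\<alpha>(i := Suc (\<alpha> i))))
      has_sum r * series_norm r c) UNIV"
    by (simp add: d index_degree_upd mult_ac)
  then have 1: "((\<lambda>\<alpha>. \<bar>d \<alpha>\<bar> * r ^ index_degree \<alpha>) has_sum r * series_norm r c) UNIV"
    by (subst (asm) has_sum_raise_index) (auto simp: d_def)
  have 2: "((\<lambda>\<alpha>. d \<alpha> * monomial x \<alpha>) has_sum x $ i * h x) UNIV" if "x \<in> cube r" for x
  proof -
    have "((\<lambda>\<alpha>. x $ i * (c \<alpha> * monomial x \<alpha>)) has_sum x $ i * h x) UNIV"
      using c that by (intro has_sum_cmult_right) (auto simp: expansion_def)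
    then have "((\<lambda>\<alpha>. d (\<alpha>(i := Suc (\<alpha> i))) * monomial x (\<alpha>(i := Suc (\<alpha> i)))) has_sum x $ i * h x) UNIV"
      by (simp add: d monomial_upd mult_ac)
    then show ?thesis by (subst (asm) has_sum_raise_index) (auto simp: d_def)
  qed
  have "r * series_norm r c \<le> r * B" using c(2) assms(2) by (rule mult_left_mono)
  from expandsI[OF 1 this 2] show ?thesis .
qed

lemma expands_add:
  assumes "expands r B h" "expands r B' h'" "r \<ge> 0"
  shows "expands r (B + B') (\<lambda>x. h x + h' x)"
proof (rule expands_has_sum[where J = "UNIV :: bool set" and h = "\<lambda>b. if b then h else h'"
      and B = "\<lambda>b. if b then B else B'"])
  show "((\<lambda>j. (if j then h else h') x) has_sum h x + h' x) UNIV" for x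
    by (rule has_sum_finiteI) (auto simp: UNIV_bool)
  show "((\<lambda>b. if b then B else B') has_sum B + B') UNIV"
    by (rule has_sum_finiteI) (auto simp: UNIV_bool)
qed (use assms in auto)

lemma expands_diff:
  assumes "expands r B h" "expands r B' h'" "r \<ge> 0"
  shows "expands r (B + B') (\<lambda>x. h x - h' x)"
  using expands_add[OF assms(1) expands_scale[OF assms(2), of "-1"]] assms(3) by simp

text \<open>Multiplication by \<open>g\<close> enters as the hypothesis \<open>step\<close>, so the
  lemma applies to coordinates before general products are available, and to general factors
  afterwards.\<close>

lemma expands_power_mult:
  assumes step: "\<And>B h. expands r B h \<Longrightarrow> expands r (s * B) (\<lambda>x. g x * h x)" and "expands r B h"
  shows "expands r (s ^ m * B) (\<lambda>x. g x ^ m * h x)"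
  by (induction m) (use assms(2) step in \<open>auto simp: mult.assoc\<close>)

lemma expands_prod_mult:
  assumes "finite I"
    and step: "\<And>i B h. i \<in> I \<Longrightarrow> expands r B h \<Longrightarrow> expands r (s i * B) (\<lambda>x. g i x * h x)"
    and "expands r B h"
  shows "expands r ((\<Prod>i\<in>I. s i ^ \<alpha> i) * B) (\<lambda>x. (\<Prod>i\<in>I. g i x ^ \<alpha> i) * h x)"
  using assms(1,2)
proof (induction I rule: finite_induct)
  case empty
  then show ?case using assms(3) by simp
next
  case (insert j I)
  have "expands r (s j ^ \<alpha> j * ((\<Prod>i\<in>I. s i ^ \<alpha> i) * B))
      (\<lambda>x. g j x ^ \<alpha> j * ((\<Prod>i\<in>I. g i x ^ \<alpha> i) * h x))"
    by (rule expands_power_mult) (use insert in auto)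
  then show ?case using insert by (simp add: mult.assoc)
qed

text \<open>Instead of forming a Cauchy product, the first factor is expanded into monomials; each
  monomial multiplies \<open>h'\<close> one coordinate at a time, and the results are summed by
  \<open>expands_has_sum\<close>.\<close>

lemma expands_mult:
  assumes "expands r B h" "expands r B' h'" "r \<ge> 0"
  shows "expands r (B * B') (\<lambda>x. h x * h' x)"
proof -
  obtain c where c: "expansion r c h" "series_norm r c \<le> B"
    using assms by (auto simp: expands_def)
  have "expands r (series_norm r c * B') (\<lambda>x. h x * h' x)"
  proof (rule expands_has_sum[where J = UNIV])
    fix \<alpha>
    have "expands r ((\<Prod>i\<in>UNIV. r ^ \<alpha> i) * B') (\<lambda>x. (\<Prod>i\<in>UNIV. x $ i ^ \<alpha> i) * h' x)"
      by (rule expands_prod_mult) (use assms expands_coord_mult in auto)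
    then have "expands r (r ^ index_degree \<alpha> * B') (\<lambda>x. monomial x \<alpha> * h' x)"
      by (simp add: monomial_def index_degree_def power_sum)
    then show "expands r (\<bar>c \<alpha>\<bar> * (r ^ index_degree \<alpha> * B')) (\<lambda>x. c \<alpha> * (monomial x \<alpha> * h' x))"
      by (rule expands_scale)
  next
    have "((\<lambda>\<alpha>. \<bar>c \<alpha>\<bar> * r ^ index_degree \<alpha> * B') has_sum series_norm r c * B') UNIV"
      using c by (intro has_sum_cmult_left) (auto simp: expansion_def series_norm_def)
    then show "((\<lambda>\<alpha>. \<bar>c \<alpha>\<bar> * (r ^ index_degree \<alpha> * B')) has_sum series_norm r c * B') UNIV"
      by (simp add: mult.assoc)
  next
    fix x :: "real^'a" assume "x \<in> cube r"
    then have "((\<lambda>\<alpha>. c \<alpha> * monomial x \<alpha> * h' x) has_sum h x * h' x) UNIV"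
      using c by (intro has_sum_cmult_left) (auto simp: expansion_def)
    then show "((\<lambda>\<alpha>. c \<alpha> * (monomial x \<alpha> * h' x)) has_sum h x * h' x) UNIV"
      by (simp add: mult.assoc)
  qed (use assms in auto)
  then show ?thesis
    by (rule expands_mono) (intro mult_right_mono c(2) expands_nonneg[OF assms(2,3)])
qed

lemma expands_coord:
  "r \<ge> 0 \<Longrightarrow> expands r r (\<lambda>x. x $ i)"
  using expands_coord_mult[OF expands_const[of r 1], of i] by simp

lemma expands_prod_power:
  assumes "finite I" "r \<ge> 0" "\<And>i. i \<in> I \<Longrightarrow> expands r (s i) (g i)"
  shows "expands r (\<Prod>i\<in>I. s i ^ \<alpha> i) (\<lambda>x. (\<Prod>i\<in>I. g i x ^ \<alpha> i))"
proof -
  have "expands r ((\<Prod>i\<in>I. s i ^ \<alpha> i) * 1) (\<lambda>x. (\<Prod>i\<in>I. g i x ^ \<alpha> i) * 1)"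
    by (rule expands_prod_mult) (use assms expands_const[of r 1] in \<open>auto intro: expands_mult\<close>)
  then show ?thesis by simp
qed

text \<open>If each component of \<open>g\<close> has norm at most the outer radius
  \<open>s\<close>, then the monomial of index \<alpha> in \<open>g\<close> has norm at most
  \<open>s ^ index_degree \<alpha>\<close>, its weight in the outer norm. Hence the bound
  \<open>B\<close> is preserved.\<close>

lemma expands_compose:
  fixes g :: "real^'b \<Rightarrow> real^'c"
  assumes "expands s B h" "r \<ge> 0" and g: "\<And>i. expands r s (\<lambda>x. g x $ i)"
  shows "expands r B (\<lambda>x. h (g x))"
proof -
  obtain c where c: "expansion s c h" "series_norm s c \<le> B"
    using assms by (auto simp: expands_def)
  have "expands r (series_norm s c) (\<lambda>x. h (g x))"
  proof (rule expands_has_sum[where J = UNIV])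
    fix \<alpha>
    have "expands r (\<Prod>i\<in>UNIV. s ^ \<alpha> i) (\<lambda>x. (\<Prod>i\<in>UNIV. g x $ i ^ \<alpha> i))"
      by (rule expands_prod_power) (use assms g in auto)
    then show "expands r (\<bar>c \<alpha>\<bar> * s ^ index_degree \<alpha>) (\<lambda>x. c \<alpha> * monomial (g x) \<alpha>)"
      by (intro expands_scale) (simp add: monomial_def index_degree_def power_sum)
  next
    show "((\<lambda>\<alpha>. \<bar>c \<alpha>\<bar> * s ^ index_degree \<alpha>) has_sum series_norm s c) UNIV"
      using c by (auto simp: expansion_def series_norm_def)
  next
    fix x :: "real^'b" assume "x \<in> cube r"
    then have "g x \<in> cube s" using expands_bound[OF g] by (auto simp: cube_iff)
    then show "((\<lambda>\<alpha>. c \<alpha> * monomial (g x) \<alpha>) has_sum h (g x)) UNIV"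
      using c by (auto simp: expansion_def)
  qed (use assms in auto)
  then show ?thesis using c(2) expands_mono by blast
qed

section \<open>Passing to smaller cubes\<close>

lemma cube_mono: "r \<le> s \<Longrightarrow> cube r \<subseteq> cube s"
  unfolding cube_def by (blast intro: order_trans)

lemma expansion_shrink:
  assumes "expansion r c h" "0 \<le> r'" "r' \<le> r"
  shows "expansion r' c h"
proof -
  have s: "(\<lambda>\<alpha>. \<bar>c \<alpha>\<bar> * r ^ index_degree \<alpha>) summable_on UNIV"
    using assms by (simp add: expansion_def)
  have "(\<lambda>\<alpha>. \<bar>c \<alpha>\<bar> * r' ^ index_degree \<alpha>) summable_on UNIV"
    by (rule summable_on_comparison_test[OF s])
      (use assms in \<open>auto intro!: mult_left_mono power_mono\<close>)
  then show ?thesis using assms cube_mono[OF assms(3)] by (auto simp: expansion_def)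
qed

text \<open>Without a constant term every contributing monomial has degree at least 1, so its weight
  gains at least one factor \<open>r' / r\<close>.\<close>

lemma series_norm_shrink:
  assumes s: "(\<lambda>\<alpha>. \<bar>c \<alpha>\<bar> * r ^ index_degree \<alpha>) summable_on UNIV"
    and "c (\<lambda>_. 0) = 0" "0 \<le> r'" "r' \<le> r" "r > 0"
  shows "series_norm r' c \<le> (r' / r) * series_norm r c"
proof -
  have b: "\<bar>c \<alpha>\<bar> * r' ^ index_degree \<alpha> \<le> (r' / r) * (\<bar>c \<alpha>\<bar> * r ^ index_degree \<alpha>)" for \<alpha>
  proof (cases "index_degree \<alpha>")
    case 0
    then show ?thesis using assms by (auto simp: index_degree_eq_0)
  next
    case (Suc m)
    have "r' ^ m \<le> r ^ m" using assms by (intro power_mono) auto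
    then have "r' * r' ^ m \<le> r' * r ^ m" using assms by (intro mult_left_mono) auto
    from mult_left_mono[OF this, of "\<bar>c \<alpha>\<bar>"] show ?thesis using Suc assms by (simp add: mult_ac)
  qed
  have s': "(\<lambda>\<alpha>. (r' / r) * (\<bar>c \<alpha>\<bar> * r ^ index_degree \<alpha>)) summable_on UNIV"
    using s by (rule summable_on_cmult_right)
  have "(\<lambda>\<alpha>. \<bar>c \<alpha>\<bar> * r' ^ index_degree \<alpha>) summable_on UNIV"
    by (rule summable_on_comparison_test[OF s' b]) (use assms in auto)
  then have "series_norm r' c \<le> (\<Sum>\<^sub>\<infinity>\<alpha>. (r' / r) * (\<bar>c \<alpha>\<bar> * r ^ index_degree \<alpha>))"
    unfolding series_norm_def by (intro infsum_mono s' b)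
  then show ?thesis by (simp only: series_norm_def infsum_cmult_right')
qed

lemma expands_shrink_zero:
  assumes "expands r B h" "h 0 = 0" "0 \<le> r'" "r' \<le> r" "r > 0"
  shows "expands r' ((r' / r) * B) h"
proof -
  obtain c where c: "expansion r c h" "series_norm r c \<le> B"
    using assms by (auto simp: expands_def)
  have "c (\<lambda>_. 0) = 0" using expansion_at_0[OF c(1)] assms by auto
  then have "series_norm r' c \<le> (r' / r) * series_norm r c"
    using c assms by (intro series_norm_shrink) (auto simp: expansion_def)
  also have "\<dots> \<le> (r' / r) * B" using assms by (intro mult_left_mono c) auto
  finally show ?thesis using expansion_shrink[OF c(1)] assms by (auto simp: expands_def)
qed

section \<open>Real analytic functions and termwise differentiation\<close>

lemma expands_small:
  assumes "expands R B h" "h 0 = 0" "R > 0" "s > 0"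
  obtains r0 where "0 < r0" "r0 \<le> R" "\<And>r. 0 \<le> r \<Longrightarrow> r \<le> r0 \<Longrightarrow> expands r s h"
proof -
  have B: "B \<ge> 0" using expands_nonneg[OF assms(1)] assms(3) by simp
  \<comment> \<open>The linear gain \<open>r / R\<close> must bring \<open>B\<close> below
    \<open>s\<close>; using \<open>B + 1\<close> keeps the denominator positive.\<close>
  define r0 where "r0 = min R (R * s / (B + 1))"
  have "0 < r0" "r0 \<le> R" using assms B by (auto simp: r0_def)
  moreover have "expands r s h" if "0 \<le> r" "r \<le> r0" for r
  proof (rule expands_mono[OF expands_shrink_zero[OF assms(1,2)]])
    have "r * (B + 1) \<le> R * s" using that B by (simp add: r0_def field_simps)
    moreover have "r * B \<le> r * (B + 1)" using that by (simp add: mult_left_mono)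
    ultimately show "r / R * B \<le> s" using assms by (simp add: field_simps)
  qed (use that assms \<open>r0 \<le> R\<close> in auto)
  ultimately show ?thesis by (rule that)
qed

text \<open>Re-expansion about \<open>a\<close> is substitution of the translation, whose components
  have norm at most \<open>\<bar>a $ i\<bar> + r\<close>.\<close>

lemma expands_shift:
  fixes a :: "real^'n"
  assumes "expands R B h" "r \<ge> 0" "\<And>i. \<bar>a $ i\<bar> + r \<le> R"
  shows "expands r B (\<lambda>y. h (a + y))"
proof (rule expands_compose[OF assms(1,2)])
  fix i
  have "expands r (\<bar>a $ i\<bar> + r) (\<lambda>y::real^'n. a $ i + y $ i)"
    using assms(2) by (intro expands_add expands_const expands_coord)
  then show "expands r R (\<lambda>y. (a + y) $ i)" using assms(3) expands_mono by fastforce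
qed

lemma monomial_const: "monomial (\<chi> i. s) \<alpha> = s ^ index_degree \<alpha>"
  by (simp add: monomial_def index_degree_def power_sum)

lemma real_analytic_on_monomial:
  "h real_analytic_on S \<longleftrightarrow>
     (\<forall>x0\<in>S. \<exists>c r. r > 0 \<and>
        (\<forall>x\<in>ball x0 r. (\<lambda>\<alpha>. c \<alpha> * monomial (x - x0) \<alpha>) summable_on UNIV) \<and>
        (\<forall>x\<in>ball x0 r \<inter> S. ((\<lambda>\<alpha>. c \<alpha> * monomial (x - x0) \<alpha>) has_sum h x) UNIV))"
  by (simp add: real_analytic_on_def monomial_def)

text \<open>The extension \<open>k\<close> agrees with \<open>h\<close> only on \<open>S\<close>, which matters when \<open>x0\<close> is not
  interior to \<open>S\<close>.\<close>

lemma real_analytic_on_iff: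
  fixes S :: "(real^'n) set"
  shows "h real_analytic_on S \<longleftrightarrow>
    (\<forall>x0\<in>S. \<exists>k r B. r > 0 \<and> expands r B (\<lambda>y. k (x0 + y)) \<and>
        (\<forall>x\<in>S. x - x0 \<in> cube r \<longrightarrow> k x = h x))"
proof
  assume h: "h real_analytic_on S"
  show "\<forall>x0\<in>S. \<exists>k r B. r > 0 \<and> expands r B (\<lambda>y. k (x0 + y)) \<and>
        (\<forall>x\<in>S. x - x0 \<in> cube r \<longrightarrow> k x = h x)"
  proof
    fix x0 assume "x0 \<in> S"
    with h obtain c r where r: "r > 0"
      and sm: "\<And>x. x \<in> ball x0 r \<Longrightarrow> (\<lambda>\<alpha>. c \<alpha> * monomial (x - x0) \<alpha>) summable_on UNIV"
      and hs: "\<And>x. x \<in> ball x0 r \<inter> S \<Longrightarrow> ((\<lambda>\<alpha>. c \<alpha> * monomial (x - x0) \<alpha>) has_sum h x) UNIV"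
      unfolding real_analytic_on_monomial by (meson IntI)
    \<comment> \<open>The Euclidean norm is at most the sum of the coordinates' moduli, so the cube
      of this radius fits into the ball of radius \<open>r\<close>.\<close>
    define s where "s = r / (real CARD('n) + 1)"
    have s: "s > 0" using r by (simp add: s_def)
    have near: "x0 + y \<in> ball x0 r" if "y \<in> cube s" for y
    proof -
      have "norm y \<le> (\<Sum>i\<in>UNIV. \<bar>y $ i\<bar>)" by (rule norm_le_l1_cart)
      also have "\<dots> \<le> (\<Sum>i\<in>(UNIV :: 'n set). s)" using that by (intro sum_mono) (simp add: cube_iff)
      also have "\<dots> < r" using r by (simp add: s_def field_simps)
      finally show ?thesis by (simp add: dist_norm)
    qed
    \<comment> \<open>Convergence is tested at the corner (s, ..., s) of the cube, where the
      monomials become the weights; for real families summability is absolute.\<close>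
    have "(\<lambda>\<alpha>. c \<alpha> * s ^ index_degree \<alpha>) summable_on UNIV"
      using sm[OF near[of "\<chi> i. s"]] s by (simp add: monomial_const cube_iff)
    then have "(\<lambda>\<alpha>. \<bar>c \<alpha> * s ^ index_degree \<alpha>\<bar>) summable_on UNIV"
      using summable_on_iff_abs_summable_on_real by fastforce
    then have s1: "(\<lambda>\<alpha>. \<bar>c \<alpha>\<bar> * s ^ index_degree \<alpha>) summable_on UNIV"
      using s by (simp add: abs_mult)
    define k where "k x = (\<Sum>\<^sub>\<infinity>\<alpha>. c \<alpha> * monomial (x - x0) \<alpha>)" for x
    have "expansion s c (\<lambda>y. k (x0 + y))"
      using s1 expansion_summable[OF s1] unfolding expansion_def k_def by simp
    then have "expands s (series_norm s c) (\<lambda>y. k (x0 + y))" by (auto simp: expands_def)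
    moreover have "k x = h x" if "x \<in> S" "x - x0 \<in> cube s" for x
      using hs[of x] near[OF that(2)] that(1) unfolding k_def by (auto intro: infsumI)
    ultimately show "\<exists>k r B. r > 0 \<and> expands r B (\<lambda>y. k (x0 + y)) \<and>
        (\<forall>x\<in>S. x - x0 \<in> cube r \<longrightarrow> k x = h x)" using s by blast
  qed
next
  assume h: "\<forall>x0\<in>S. \<exists>k r B. r > 0 \<and> expands r B (\<lambda>y. k (x0 + y)) \<and>
        (\<forall>x\<in>S. x - x0 \<in> cube r \<longrightarrow> k x = h x)"
  show "h real_analytic_on S"
    unfolding real_analytic_on_monomial
  proof
    fix x0 assume "x0 \<in> S"
    with h obtain k r B where r: "r > 0" and k: "expands r B (\<lambda>y. k (x0 + y))"
      and kh: "\<And>x. x \<in> S \<Longrightarrow> x - x0 \<in> cube r \<Longrightarrow> k x = h x" by blast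
    obtain c where c: "expansion r c (\<lambda>y. k (x0 + y))" using k by (auto simp: expands_def)
    have near: "x - x0 \<in> cube r" if "x \<in> ball x0 r" for x
      using that component_le_norm_cart[of "x - x0"] unfolding cube_iff
      by (auto simp: dist_norm norm_minus_commute intro: order_trans less_imp_le)
    have "((\<lambda>\<alpha>. c \<alpha> * monomial (x - x0) \<alpha>) has_sum k x) UNIV" if "x \<in> ball x0 r" for x
      using c near[OF that] by (auto simp: expansion_def dest!: bspec[of _ _ "x - x0"])
    then have "(\<forall>x\<in>ball x0 r. (\<lambda>\<alpha>. c \<alpha> * monomial (x - x0) \<alpha>) summable_on UNIV) \<and>
        (\<forall>x\<in>ball x0 r \<inter> S. ((\<lambda>\<alpha>. c \<alpha> * monomial (x - x0) \<alpha>) has_sum h x) UNIV)"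
      using kh near has_sum_imp_summable by fastforce
    then show "\<exists>c r. r > 0 \<and>
        (\<forall>x\<in>ball x0 r. (\<lambda>\<alpha>. c \<alpha> * monomial (x - x0) \<alpha>) summable_on UNIV) \<and>
        (\<forall>x\<in>ball x0 r \<inter> S. ((\<lambda>\<alpha>. c \<alpha> * monomial (x - x0) \<alpha>) has_sum h x) UNIV)"
      using r by blast
  qed
qed

section \<open>Closure properties of real analytic functions\<close>

lemma real_analytic_on_subset: "h real_analytic_on S \<Longrightarrow> S' \<subseteq> S \<Longrightarrow> h real_analytic_on S'"
  unfolding real_analytic_on_iff by (meson subsetD)

lemma real_analytic_on_cong:
  assumes "h real_analytic_on S" "\<And>x. x \<in> S \<Longrightarrow> h x = h' x"
  shows "h' real_analytic_on S"
  using assms(1) unfolding real_analytic_on_iff by (simp add: assms(2))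

lemma finite_uniform_radius:
  fixes P :: "'n::finite \<Rightarrow> real \<Rightarrow> bool"
  assumes "\<And>i. \<exists>r0>0. \<forall>r. 0 < r \<longrightarrow> r \<le> r0 \<longrightarrow> P i r"
  obtains r where "r > 0" "\<And>i. P i r"
proof -
  obtain f where f: "\<And>i. f i > 0" "\<And>i r. 0 < r \<Longrightarrow> r \<le> f i \<Longrightarrow> P i r" using assms by metis
  have "Min (range f) > 0" using f(1) by (subst Min_gr_iff) auto
  then show ?thesis using f(2) by (intro that[of "Min (range f)"]) auto
qed

lemma real_analytic_on_compose:
  fixes g :: "real^'n \<Rightarrow> real^'n"
  assumes h: "h real_analytic_on T" and g: "\<And>i. (\<lambda>x. g x $ i) real_analytic_on S" and "g ` S \<subseteq> T"
  shows "(\<lambda>x. h (g x)) real_analytic_on S"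
  unfolding real_analytic_on_iff
proof
  fix x0 assume x0: "x0 \<in> S"
  obtain kh s B where s: "s > 0" and kh: "expands s B (\<lambda>y. kh (g x0 + y))"
    and khh: "\<And>x. x \<in> T \<Longrightarrow> x - g x0 \<in> cube s \<Longrightarrow> kh x = h x"
    using h x0 assms(3) unfolding real_analytic_on_iff by blast
  have "\<exists>k r B. r > 0 \<and> expands r B (\<lambda>y. k (x0 + y)) \<and>
        (\<forall>x\<in>S. x - x0 \<in> cube r \<longrightarrow> k x = g x $ i)" for i
    using g x0 unfolding real_analytic_on_iff by blast
  then obtain k R C where R: "\<And>i. R i > 0" and k: "\<And>i. expands (R i) (C i) (\<lambda>y. k i (x0 + y))"
    and kg: "\<And>i x. x \<in> S \<Longrightarrow> x - x0 \<in> cube (R i) \<Longrightarrow> k i x = g x $ i"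
    by metis
  have kx0: "k i x0 = g x0 $ i" for i
    using kg[OF x0, of i] R[of i] by (simp add: cube_iff)
  \<comment> \<open>Since \<open>x0\<close> lies in \<open>S\<close>, each extension takes the value
    of \<open>g\<close> at \<open>x0\<close>. Once that value is subtracted nothing constant
    remains, and shrinking the cube brings the norm below the outer radius \<open>s\<close>.\<close>
  have "\<exists>r0>0. \<forall>r. 0 < r \<longrightarrow> r \<le> r0 \<longrightarrow> r \<le> R i \<and> expands r s (\<lambda>y. k i (x0 + y) - g x0 $ i)" for i
  proof -
    have "expands (R i) (C i + \<bar>g x0 $ i\<bar>) (\<lambda>y. k i (x0 + y) - g x0 $ i)"
      by (intro expands_diff k expands_const less_imp_le R)
    then obtain r0 where "0 < r0" "r0 \<le> R i"
      "\<And>r. 0 \<le> r \<Longrightarrow> r \<le> r0 \<Longrightarrow> expands r s (\<lambda>y. k i (x0 + y) - g x0 $ i)"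
      by (rule expands_small) (use kx0 R s in auto)
    then show ?thesis by (intro exI[of _ r0]) auto
  qed
  then obtain r where r: "r > 0"
    and rR_ex: "\<And>i. r \<le> R i \<and> expands r s (\<lambda>y. k i (x0 + y) - g x0 $ i)"
    using finite_uniform_radius[of "\<lambda>i r. r \<le> R i \<and> expands r s (\<lambda>y. k i (x0 + y) - g x0 $ i)"]
    by metis
  note rR = rR_ex[THEN conjunct1] and ex = rR_ex[THEN conjunct2]
  define G where "G x = (\<chi> i. k i x)" for x
  have "expands r B (\<lambda>y. kh (g x0 + (G (x0 + y) - g x0)))"
    by (rule expands_compose[OF kh]) (use r ex in \<open>auto simp: G_def\<close>)
  then have "expands r B (\<lambda>y. kh (G (x0 + y)))" by simp
  moreover have "kh (G x) = h (g x)" if x: "x \<in> S" "x - x0 \<in> cube r" for x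
  proof -
    have "G x = g x" using kg[OF x(1)] x(2) cube_mono[OF rR] by (auto simp: G_def vec_eq_iff)
    moreover have "\<bar>k i (x0 + (x - x0)) - g x0 $ i\<bar> \<le> s" for i by (rule expands_bound[OF ex x(2)])
    then have "G x - g x0 \<in> cube s" by (simp add: cube_iff G_def)
    ultimately show ?thesis using khh[of "g x"] x assms(3) by auto
  qed
  ultimately show "\<exists>k r B. r > 0 \<and> expands r B (\<lambda>y. k (x0 + y)) \<and>
        (\<forall>x\<in>S. x - x0 \<in> cube r \<longrightarrow> k x = h (g x))" using r by (intro exI[of _ "\<lambda>x. kh (G x)"]) blast
qed

text \<open>Coefficients of the formal derivative in coordinate \<open>k\<close>. At index 0 the
  iterate for \<open>i\<close> and \<open>j\<close> is the value of the mixed second derivative at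
  the centre.\<close>

definition derivative_coeff :: "'n \<Rightarrow> (('n::finite \<Rightarrow> nat) \<Rightarrow> real) \<Rightarrow> ('n \<Rightarrow> nat) \<Rightarrow> real" where
  "derivative_coeff k c \<beta> = real (Suc (\<beta> k)) * c (\<beta>(k := Suc (\<beta> k)))"

definition series_value :: "(('n::finite \<Rightarrow> nat) \<Rightarrow> real) \<Rightarrow> real^'n \<Rightarrow> real" where
  "series_value c x = (\<Sum>\<^sub>\<infinity>\<alpha>. c \<alpha> * monomial x \<alpha>)"

lemma expansion_series_value:
  "(\<lambda>\<alpha>. \<bar>c \<alpha>\<bar> * r ^ index_degree \<alpha>) summable_on UNIV \<Longrightarrow> expansion r c (series_value c)"
  unfolding expansion_def series_value_def by (auto intro!: has_sum_infsum expansion_summable)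

lemma expansion_imp_expands: "expansion r c h \<Longrightarrow> expands r (series_norm r c) h"
  by (auto simp: expands_def)

lemma derivative_coeff_commute:
  "derivative_coeff i (derivative_coeff j c) = derivative_coeff j (derivative_coeff i c)"
proof (cases "i = j")
  case False
  then show ?thesis by (auto simp: derivative_coeff_def fun_upd_twist)
qed simp

lemma component_le_index_degree: "\<beta> k \<le> index_degree \<beta>"
  unfolding index_degree_def by (rule member_le_sum) auto

text \<open>Differentiation multiplies a coefficient by at most its degree. A strictly smaller
  radius absorbs this, because \<open>n * q ^ n\<close> is bounded for
  \<open>q = r / R < 1\<close>.\<close>

lemma derivative_coeff_summable:
  assumes s: "(\<lambda>\<alpha>. \<bar>c \<alpha>\<bar> * R ^ index_degree \<alpha>) summable_on UNIV" and r: "0 < r" "r < R"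
  shows "(\<lambda>\<beta>. \<bar>derivative_coeff k c \<beta>\<bar> * r ^ index_degree \<beta>) summable_on UNIV"
proof -
  define q where "q = r / R"
  have q: "norm q < 1" using r by (simp add: q_def)
  have "Bseq (\<lambda>n. real n * q ^ n)"
    using powser_times_n_limit_0[OF q] by (intro convergent_imp_Bseq) (auto simp: convergent_def)
  then obtain K where K: "\<And>n. \<bar>real n * q ^ n\<bar> \<le> K" unfolding Bseq_def by auto
  have "(\<lambda>\<beta>. \<bar>c (\<beta>(k := Suc (\<beta> k)))\<bar> * R ^ index_degree (\<beta>(k := Suc (\<beta> k)))) summable_on UNIV"
    using summable_on_reindex[OF inj_raise_index[of k],
        of "\<lambda>\<alpha>. \<bar>c \<alpha>\<bar> * R ^ index_degree \<alpha>"] summable_on_subset[OF s]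
    by (simp add: o_def)
  then have t: "(\<lambda>\<beta>. (K / r) * (\<bar>c (\<beta>(k := Suc (\<beta> k)))\<bar> * R ^ index_degree (\<beta>(k := Suc (\<beta> k)))))
      summable_on UNIV"
    by (rule summable_on_cmult_right)
  show ?thesis
  proof (rule summable_on_comparison_test[OF t])
    fix \<beta> :: "'a \<Rightarrow> nat"
    define m where "m = index_degree \<beta>"
    have rm: "r ^ m = q ^ Suc m * R ^ Suc m / r" using r by (simp add: q_def power_divide)
    have "real (Suc (\<beta> k)) * r ^ m \<le> real (Suc m) * r ^ m"
      using component_le_index_degree[of \<beta> k] r by (intro mult_right_mono) (auto simp: m_def)
    also have "\<dots> = (real (Suc m) * q ^ Suc m) * (R ^ Suc m / r)" by (simp add: rm)
    also have "\<dots> \<le> K * (R ^ Suc m / r)"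
      using K[of "Suc m"] r by (intro mult_right_mono) auto
    finally have "\<bar>c (\<beta>(k := Suc (\<beta> k)))\<bar> * (real (Suc (\<beta> k)) * r ^ m)
        \<le> \<bar>c (\<beta>(k := Suc (\<beta> k)))\<bar> * (K * (R ^ Suc m / r))" by (rule mult_left_mono) simp
    then show "\<bar>derivative_coeff k c \<beta>\<bar> * r ^ index_degree \<beta>
        \<le> K / r * (\<bar>c (\<beta>(k := Suc (\<beta> k)))\<bar> * R ^ index_degree (\<beta>(k := Suc (\<beta> k))))"
      by (simp add: derivative_coeff_def abs_mult index_degree_upd m_def mult_ac)
  qed (use r in auto)
qed

text \<open>For \<open>\<alpha> k = 0\<close> the truncated \<open>\<alpha> k - 1\<close> is
  harmless, as the factor \<open>real (\<alpha> k)\<close> vanishes.\<close>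

lemma monomial_has_derivative:
  "((\<lambda>x. monomial x \<alpha>) has_derivative
     (\<lambda>v. \<Sum>k\<in>UNIV. (real (\<alpha> k) * monomial x (\<alpha>(k := \<alpha> k - 1))) * v $ k)) (at x within S)"
proof -
  have d: "((\<lambda>x. x $ i ^ \<alpha> i) has_derivative (\<lambda>v. real (\<alpha> i) * x $ i ^ (\<alpha> i - 1) * v $ i)) (at x within S)" for i
    by (auto intro!: derivative_eq_intros bounded_linear.has_derivative[OF bounded_linear_vec_nth]
        simp: mult_ac)
  have m: "monomial x (\<alpha>(k := \<alpha> k - 1)) = x $ k ^ (\<alpha> k - 1) * (\<Prod>j\<in>UNIV - {k}. x $ j ^ \<alpha> j)" for k
    unfolding monomial_def by (subst prod.remove[of _ k]) (auto intro!: prod.cong)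
  have "((\<lambda>x. \<Prod>i\<in>UNIV. x $ i ^ \<alpha> i) has_derivative
      (\<lambda>v. \<Sum>i\<in>UNIV. (real (\<alpha> i) * x $ i ^ (\<alpha> i - 1) * v $ i) * (\<Prod>j\<in>UNIV - {i}. x $ j ^ \<alpha> j)))
      (at x within S)"
    by (rule has_derivative_prod) (rule d)
  then show ?thesis unfolding m unfolding monomial_def by (simp add: mult_ac)
qed

text \<open>Termwise differentiation of a sequence of functions on a convex set; the derivatives
  converge uniformly by the M-test with majorants \<open>M k\<close>, the weighted coefficients of
  the formal derivatives.\<close>

lemma expansion_has_derivative:
  fixes F :: "real^'n \<Rightarrow> real"
  assumes F: "expansion R c F" and r: "0 < r" "r < R" and x: "\<And>i. \<bar>x $ i\<bar> < r"
  shows "(F has_derivative (\<lambda>v. \<Sum>k\<in>UNIV. series_value (derivative_coeff k c) x * v $ k)) (at x)"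
proof -
  define U :: "(real^'n) set" where "U = {x. \<forall>i. \<bar>x $ i\<bar> < r}"
  have U_box: "U = box (\<chi> i. - r) (\<chi> i. r)" by (auto simp: U_def mem_box_cart abs_less_iff minus_less_iff)
  have U: "convex U" "open U" "x \<in> U" using x by (simp_all add: U_box convex_box open_box) (simp add: U_box[symmetric] U_def)
  have UR: "y \<in> cube R" "y \<in> cube r" if "y \<in> U" for y
    using that r by (auto simp: U_def cube_iff intro: less_imp_le dest: spec order_less_trans)
  have cs: "(\<lambda>\<alpha>. \<bar>c \<alpha>\<bar> * R ^ index_degree \<alpha>) summable_on UNIV" using F by (simp add: expansion_def)
  define T where "T \<alpha> k x = c \<alpha> * (real (\<alpha> k) * monomial x (\<alpha>(k := \<alpha> k - 1)))" for \<alpha> k and x :: "real^'n"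
  define M where "M k \<alpha> = \<bar>c \<alpha>\<bar> * (real (\<alpha> k) * r ^ index_degree (\<alpha>(k := \<alpha> k - 1)))" for k and \<alpha> :: "'n \<Rightarrow> nat"
  have dG: "expansion r (derivative_coeff k c) (series_value (derivative_coeff k c))" for k
    by (intro expansion_series_value derivative_coeff_summable[OF cs r])
  have TG: "((\<lambda>\<alpha>. T \<alpha> k y) has_sum series_value (derivative_coeff k c) y) UNIV" if "y \<in> U" for k y
  proof -
    have "((\<lambda>\<beta>. T (\<beta>(k := Suc (\<beta> k))) k y) has_sum series_value (derivative_coeff k c) y) UNIV"
      using dG[of k] UR(2)[OF that] by (simp add: expansion_def derivative_coeff_def T_def mult_ac)
    then show ?thesis by (subst (asm) has_sum_raise_index) (auto simp: T_def)
  qed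
  have Ms: "M k summable_on UNIV" for k
  proof -
    have "((\<lambda>\<beta>. M k (\<beta>(k := Suc (\<beta> k)))) has_sum series_norm r (derivative_coeff k c)) UNIV"
      using dG[of k] by (simp add: expansion_def derivative_coeff_def M_def series_norm_def abs_mult mult_ac)
    then have "(M k has_sum series_norm r (derivative_coeff k c)) UNIV"
      by (subst (asm) has_sum_raise_index) (auto simp: M_def)
    then show ?thesis by (rule has_sum_imp_summable)
  qed
  have TM: "\<bar>T \<alpha> k y\<bar> \<le> M k \<alpha>" if "y \<in> U" for \<alpha> k y
    unfolding T_def M_def abs_mult
    by (simp add: mult_left_mono abs_monomial_le UR(2)[OF that])
  have "infinite (UNIV :: ('n \<Rightarrow> nat) set)"
    using finite_fun_UNIVD2[where 'a = 'n and 'b = nat] card_eq_0_iff infinite_UNIV_nat by fastforce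
  then have e: "bij_betw (from_nat_into (UNIV :: ('n \<Rightarrow> nat) set)) UNIV UNIV"
    by (intro bij_betw_from_nat_into) auto
  \<comment> \<open>Multi-indices are enumerated by the naturals to reach theorems on ordinary
    series; an unordered sum has the same value along any enumeration.\<close>
  define e where "e = from_nat_into (UNIV :: ('n \<Rightarrow> nat) set)"
  have sums_e: "(\<lambda>n. f (e n)) sums s" if "(f has_sum s) UNIV" for f :: "('n \<Rightarrow> nat) \<Rightarrow> real" and s
    using has_sum_reindex_bij_betw[OF e, of f s] that unfolding e_def by (intro has_sum_imp_sums) simp
  have "\<exists>g. \<forall>x\<in>U. (\<lambda>n. c (e n) * monomial x (e n)) sums g x \<and>
     (g has_derivative (\<lambda>v. \<Sum>k\<in>UNIV. series_value (derivative_coeff k c) x * v $ k)) (at x within U)"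
  proof (rule has_derivative_series[OF U(1) _ _ U(3)])
    show "((\<lambda>x. c (e n) * monomial x (e n)) has_derivative (\<lambda>v. \<Sum>k\<in>UNIV. T (e n) k y * v $ k))
        (at y within U)" for n y
      using has_derivative_mult_right[OF monomial_has_derivative[of "e n" y U], of "c (e n)"]
      by (simp add: T_def sum_distrib_left mult_ac)
    show "(\<lambda>n. c (e n) * monomial x (e n)) sums F x"
      using F UR(1)[OF U(3)] by (intro sums_e) (auto simp: expansion_def)
    fix \<epsilon> :: real assume \<epsilon>: "\<epsilon> > 0"
    \<comment> \<open>The error is split evenly over the coordinates, whose contributions are added
      up below.\<close>
    define \<delta> where "\<delta> = \<epsilon> / real CARD('n)"
    have \<delta>: "\<delta> > 0" using \<epsilon> by (simp add: \<delta>_def)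
    have "\<forall>\<^sub>F n in sequentially. \<forall>y\<in>U. \<bar>(\<Sum>i<n. T (e i) k y) - series_value (derivative_coeff k c) y\<bar> < \<delta>" for k
    proof -
      have "summable (\<lambda>n. M k (e n))" using sums_e has_sum_infsum[OF Ms] sums_summable by blast
      then have "uniform_limit U (\<lambda>n y. \<Sum>i<n. T (e i) k y) (\<lambda>y. \<Sum>i. T (e i) k y) sequentially"
        using TM by (intro Weierstrass_m_test) auto
      then have "uniform_limit U (\<lambda>n y. \<Sum>i<n. T (e i) k y) (series_value (derivative_coeff k c)) sequentially"
        by (rule uniform_limit_cong'[THEN iffD1, rotated 2])
          (auto dest: TG sums_e sums_unique[symmetric])
      then show ?thesis using \<delta> by (auto simp: uniform_limit_iff dist_norm)
    qed
    then have "\<forall>\<^sub>F n in sequentially. \<forall>k. \<forall>y\<in>U.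
        \<bar>(\<Sum>i<n. T (e i) k y) - series_value (derivative_coeff k c) y\<bar> < \<delta>"
      by (simp add: eventually_all_finite)
    then show "\<forall>\<^sub>F n in sequentially. \<forall>y\<in>U. \<forall>v. norm ((\<Sum>i<n. \<Sum>k\<in>UNIV. T (e i) k y * v $ k) -
        (\<Sum>k\<in>UNIV. series_value (derivative_coeff k c) y * v $ k)) \<le> \<epsilon> * norm v"
    proof eventually_elim
      case (elim n)
      show ?case
      proof (intro ballI allI)
        fix y and v :: "real^'n" assume y: "y \<in> U"
        have "(\<Sum>i<n. \<Sum>k\<in>UNIV. T (e i) k y * v $ k) - (\<Sum>k\<in>UNIV. series_value (derivative_coeff k c) y * v $ k)
            = (\<Sum>k\<in>UNIV. ((\<Sum>i<n. T (e i) k y) - series_value (derivative_coeff k c) y) * v $ k)"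
          by (subst sum.swap) (simp add: sum_distrib_right sum_subtractf left_diff_distrib)
        also have "norm \<dots> \<le> (\<Sum>k\<in>(UNIV :: 'n set). \<delta> * norm v)"
        proof (rule sum_norm_le)
          fix k
          show "norm (((\<Sum>i<n. T (e i) k y) - series_value (derivative_coeff k c) y) * v $ k) \<le> \<delta> * norm v"
            unfolding norm_mult using elim y \<delta>
            by (intro mult_mono) (auto simp: component_le_norm_cart intro: less_imp_le)
        qed
        also have "\<dots> = \<epsilon> * norm v" by (simp add: \<delta>_def)
        finally show "norm ((\<Sum>i<n. \<Sum>k\<in>UNIV. T (e i) k y * v $ k) -
          (\<Sum>k\<in>UNIV. series_value (derivative_coeff k c) y * v $ k)) \<le> \<epsilon> * norm v" .
      qed
    qed
  qed
  then obtain G where G: "\<And>x. x \<in> U \<Longrightarrow> (\<lambda>n. c (e n) * monomial x (e n)) sums G x"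
    and G': "(G has_derivative (\<lambda>v. \<Sum>k\<in>UNIV. series_value (derivative_coeff k c) x * v $ k)) (at x within U)"
    using U(3) by blast
  have GF: "G y = F y" if "y \<in> U" for y
  proof -
    have "(\<lambda>n. c (e n) * monomial y (e n)) sums F y"
      using F UR(1)[OF that] by (intro sums_e) (auto simp: expansion_def)
    then show ?thesis using G[OF that] sums_unique2 by blast
  qed
  from G' have "(G has_derivative (\<lambda>v. \<Sum>k\<in>UNIV. series_value (derivative_coeff k c) x * v $ k)) (at x)"
    by (simp only: at_within_open[OF U(3,2)])
  then show ?thesis by (rule has_derivative_transform_within_open[OF _ U(2,3)]) (use GF in auto)
qed

section \<open>Identity theorem and implicit functions\<close>

text \<open>The constant coefficient is the limit at 0, hence 0; dividing by \<open>t\<close>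
  exposes the next one. The assumption is restricted to nonzero \<open>t\<close> so that it survives
  the division.\<close>

lemma powser_zero_coeffs:
  fixes a :: "nat \<Rightarrow> real"
  assumes "s > 0" and a: "\<And>t. t \<noteq> 0 \<Longrightarrow> \<bar>t\<bar> < s \<Longrightarrow> (\<lambda>n. a n * t ^ n) sums 0"
  shows "a m = 0"
proof -
  have z: "b 0 = 0" if "\<And>t. t \<noteq> 0 \<Longrightarrow> \<bar>t\<bar> < s \<Longrightarrow> (\<lambda>n. b n * t ^ n) sums 0" for b :: "nat \<Rightarrow> real"
    using powser_limit_0_strong[OF assms(1), of b "\<lambda>_. 0"] that LIM_const_eq[of 0 "b 0" 0] by force
  have "(\<lambda>n. a (n + m) * t ^ n) sums 0" if "t \<noteq> 0" "\<bar>t\<bar> < s" for t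
    using that
  proof (induction m arbitrary: t)
    case 0
    then show ?case using a by simp
  next
    case (Suc m)
    have "a m = 0" using z[of "\<lambda>n. a (n + m)"] Suc.IH by simp
    then have "(\<lambda>n. a (n + m) * t ^ n) sums (0 + a (0 + m) * t ^ 0)"
      using Suc.IH[OF Suc.prems] by simp
    from iffD2[OF sums_Suc_iff this]
    have "(\<lambda>n. a (Suc n + m) * t ^ Suc n) sums 0" .
    then have "(\<lambda>n. (a (Suc n + m) * t ^ Suc n) / t) sums (0 / t)" by (rule sums_divide)
    then show ?case using Suc.prems by (simp add: field_simps)
  qed
  from z[of "\<lambda>n. a (n + m)", OF this] show ?thesis by simp
qed

lemma monomial_scaleR: "monomial (t *\<^sub>R y) \<alpha> = t ^ index_degree \<alpha> * monomial y \<alpha>"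
  by (simp add: monomial_def index_degree_def power_mult_distrib prod.distrib power_sum)

text \<open>Grouping the terms by degree turns the restriction of \<open>h\<close> to each ray from the origin into a
  power series in one variable.\<close>

lemma expands_identity:
  fixes h :: "real^'n \<Rightarrow> real"
  assumes h: "expands r B h" and "r > 0" and z: "eventually (\<lambda>y. h y = 0) (nhds 0)" and y: "y \<in> cube r"
  shows "h y = 0"
proof -
  obtain c where c: "expansion r c h" using h by (auto simp: expands_def)
  define b where "b m = (\<Sum>\<^sub>\<infinity>\<alpha> | index_degree \<alpha> = m. c \<alpha> * monomial y \<alpha>)" for m
  have cs: "(\<lambda>\<alpha>. c \<alpha> * monomial y \<alpha>) summable_on UNIV"
    using c y by (auto simp: expansion_def intro: has_sum_imp_summable)
  have b: "((\<lambda>\<alpha>. c \<alpha> * monomial y \<alpha>) has_sum b m) {\<alpha>. index_degree \<alpha> = m}" for m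
    unfolding b_def by (intro has_sum_infsum summable_on_subset[OF cs]) auto
  have bs: "(\<lambda>m. b m * t ^ m) sums h (t *\<^sub>R y)" if "\<bar>t\<bar> \<le> 1" for t
  proof -
    have "\<bar>t * y $ i\<bar> \<le> 1 * r" for i unfolding abs_mult
      using that y by (intro mult_mono) (auto simp: cube_iff)
    then have "((\<lambda>\<alpha>. c \<alpha> * monomial (t *\<^sub>R y) \<alpha>) has_sum h (t *\<^sub>R y)) UNIV"
      using c by (auto simp: expansion_def cube_iff)
    moreover have bij: "bij_betw snd (SIGMA m:UNIV. {\<alpha>::'n \<Rightarrow> nat. index_degree \<alpha> = m}) UNIV"
      by (auto simp: bij_betw_def inj_on_def image_iff)
    ultimately have "((\<lambda>x. c (snd x) * monomial (t *\<^sub>R y) (snd x)) has_sum h (t *\<^sub>R y))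
        (SIGMA m:UNIV. {\<alpha>. index_degree \<alpha> = m})"
      using has_sum_reindex_bij_betw[OF bij, of "\<lambda>\<alpha>. c \<alpha> * monomial (t *\<^sub>R y) \<alpha>"] by simp
    then have "((\<lambda>m. b m * t ^ m) has_sum h (t *\<^sub>R y)) UNIV"
    proof (rule has_sum_SigmaD)
      fix m
      have "((\<lambda>\<alpha>. c \<alpha> * monomial y \<alpha> * t ^ m) has_sum b m * t ^ m) {\<alpha>. index_degree \<alpha> = m}"
        by (intro has_sum_cmult_left b)
      then show "((\<lambda>\<alpha>. c (snd (m, \<alpha>)) * monomial (t *\<^sub>R y) (snd (m, \<alpha>))) has_sum b m * t ^ m)
          {\<alpha>. index_degree \<alpha> = m}"
        by (rule has_sum_cong[THEN iffD1, rotated]) (simp add: monomial_scaleR)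
    qed
    then show ?thesis by (rule has_sum_imp_sums)
  qed
  have "((\<lambda>t. t *\<^sub>R y) \<longlongrightarrow> 0) (nhds (0::real))"
    using tendsto_scaleR[OF filterlim_ident[of "nhds (0::real)"] tendsto_const[of y]] by simp
  then have "eventually (\<lambda>t::real. h (t *\<^sub>R y) = 0) (nhds 0)" using z by (rule eventually_compose_filterlim[rotated])
  then obtain e where e: "e > 0" "\<And>t. \<bar>t\<bar> < e \<Longrightarrow> h (t *\<^sub>R y) = 0"
    by (auto simp: eventually_nhds_metric dist_real_def)
  have "b m = 0" for m
  \<comment> \<open>Below \<open>e\<close> the function vanishes on the ray, and below 1 the scaled
    point stays in the cube. The conclusion uses \<open>t = 1\<close>, where the series converges
    although \<open>h\<close> is not assumed to vanish there.\<close>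
  proof (rule powser_zero_coeffs[of "min e 1"])
    show "(\<lambda>n. b n * t ^ n) sums 0" if "\<bar>t\<bar> < min e 1" for t
      using bs[of t] e(2)[of t] that by simp
  qed (use e in auto)
  then show "h y = 0" using bs[of 1] sums_unique2[OF _ sums_zero] by simp
qed

section \<open>Analytic implicit functions\<close>

definition replace_coord :: "'n \<Rightarrow> real \<Rightarrow> real^'n::finite \<Rightarrow> real^'n" where
  "replace_coord k t x = (\<chi> i. if i = k then t else x $ i)"

lemma replace_coord_nth: "replace_coord k t x $ i = (if i = k then t else x $ i)"
  by (simp add: replace_coord_def)

lemma replace_coord_replace: "replace_coord k t (replace_coord k s x) = replace_coord k t x"
  by (simp add: vec_eq_iff replace_coord_nth)

lemma replace_coord_self: "replace_coord k (x $ k) x = x"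
  by (simp add: vec_eq_iff replace_coord_nth)

lemma expands_replace_coord:
  "0 \<le> r \<Longrightarrow> \<bar>t\<bar> \<le> r \<Longrightarrow> expands r r (\<lambda>x. replace_coord k t x $ i)"
  using expands_coord expands_mono[OF expands_const] by (cases "i = k") (auto simp: replace_coord_nth)

lemma monomial_split: "monomial x \<alpha> = (\<Prod>i\<in>UNIV - {k}. x $ i ^ \<alpha> i) * x $ k ^ \<alpha> k"
  unfolding monomial_def by (subst prod.remove[of _ k]) (auto simp: mult_ac)

lemma monomial_replace_coord:
  "monomial (replace_coord k t x) \<alpha> = (\<Prod>i\<in>UNIV - {k}. x $ i ^ \<alpha> i) * t ^ \<alpha> k"
  unfolding monomial_split[of "replace_coord k t x" \<alpha> k] by (auto simp: replace_coord_nth intro!: prod.cong)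

lemma expands_power: "expands r s g \<Longrightarrow> r \<ge> 0 \<Longrightarrow> expands r (s ^ m) (\<lambda>x. g x ^ m)"
  using expands_prod_power[of "{()}" r "\<lambda>_. s" "\<lambda>_. g" "\<lambda>_. m"] by simp

text \<open>Induction on the splitting a^(m+1) - b^(m+1) = a (a^m - b^m) + (a - b) b^m. For
  \<open>m = 0\<close> the factor \<open>real m\<close> neutralises the truncated exponent.\<close>

lemma expands_power_diff:
  assumes "r \<ge> 0" "expands r s \<phi>" "expands r s \<psi>" "expands r \<delta> (\<lambda>x. \<phi> x - \<psi> x)"
  shows "expands r (\<delta> * (real m * s ^ (m - 1))) (\<lambda>x. \<phi> x ^ m - \<psi> x ^ m)"
proof (induction m)
  case 0
  then show ?case using expands_const[of r 0] by simp
next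
  case (Suc m)
  have "expands r (s * (\<delta> * (real m * s ^ (m - 1))) + \<delta> * s ^ m)
      (\<lambda>x. \<phi> x * (\<phi> x ^ m - \<psi> x ^ m) + (\<phi> x - \<psi> x) * \<psi> x ^ m)"
    by (intro expands_add expands_mult Suc expands_power assms)
  moreover have "s * (\<delta> * (real m * s ^ (m - 1))) + \<delta> * s ^ m = \<delta> * (real (Suc m) * s ^ (Suc m - 1))"
    by (cases m) (auto simp: algebra_simps)
  moreover have "(\<lambda>x. \<phi> x * (\<phi> x ^ m - \<psi> x ^ m) + (\<phi> x - \<psi> x) * \<psi> x ^ m)
      = (\<lambda>x. \<phi> x ^ Suc m - \<psi> x ^ Suc m)"
    by (auto simp: algebra_simps)
  ultimately show ?case by simp
qed

text \<open>A mean value estimate in the series norm. Only the power of coordinate \<open>k\<close>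
  changes in each monomial, and the resulting bounds sum to \<delta> times the norm of the formal
  \<open>k\<close>-derivative.\<close>

lemma expands_replace_coord_diff:
  fixes \<phi> \<psi> :: "real^'n \<Rightarrow> real"
  assumes H: "expansion s d H"
    and dH: "(\<lambda>\<beta>. \<bar>derivative_coeff k d \<beta>\<bar> * s ^ index_degree \<beta>) summable_on UNIV"
    and r: "0 \<le> r" "r \<le> s"
    and \<phi>: "expands r s \<phi>" and \<psi>: "expands r s \<psi>" and \<delta>: "expands r \<delta> (\<lambda>x. \<phi> x - \<psi> x)"
  shows "expands r (\<delta> * series_norm s (derivative_coeff k d))
    (\<lambda>x. H (replace_coord k (\<phi> x) x) - H (replace_coord k (\<psi> x) x))"
proof (rule expands_has_sum[where J = UNIV, OF r(1)])
  fix \<alpha> :: "'n \<Rightarrow> nat"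
  have coord: "expands r s (\<lambda>x::real^'n. x $ i)" for i
    using expands_coord[OF r(1)] r(2) by (rule expands_mono)
  show "expands r (\<bar>d \<alpha>\<bar> * ((\<Prod>i\<in>UNIV - {k}. s ^ \<alpha> i) * (\<delta> * (real (\<alpha> k) * s ^ (\<alpha> k - 1)))))
      (\<lambda>x. d \<alpha> * ((\<Prod>i\<in>UNIV - {k}. x $ i ^ \<alpha> i) * (\<phi> x ^ \<alpha> k - \<psi> x ^ \<alpha> k)))"
    by (intro expands_scale expands_mult expands_prod_power expands_power_diff assms coord) auto
next
  have s: "s ^ index_degree \<beta> = (\<Prod>i\<in>UNIV - {k}. s ^ \<beta> i) * s ^ \<beta> k" for \<beta> :: "'n \<Rightarrow> nat"
    using monomial_split[of "\<chi> i. s" \<beta> k] by (simp add: monomial_const)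
  let ?B = "\<lambda>\<alpha>. \<bar>d \<alpha>\<bar> * ((\<Prod>i\<in>UNIV - {k}. s ^ \<alpha> i) * (\<delta> * (real (\<alpha> k) * s ^ (\<alpha> k - 1))))"
  have p: "(\<Prod>i\<in>UNIV - {k}. s ^ (\<beta>(k := Suc (\<beta> k))) i) = (\<Prod>i\<in>UNIV - {k}. s ^ \<beta> i)" for \<beta> :: "'n \<Rightarrow> nat"
    by (intro prod.cong) auto
  have "((\<lambda>\<beta>. \<delta> * (\<bar>derivative_coeff k d \<beta>\<bar> * s ^ index_degree \<beta>))
      has_sum \<delta> * series_norm s (derivative_coeff k d)) UNIV"
    unfolding series_norm_def by (intro has_sum_cmult_right has_sum_infsum dH)
  then have "((\<lambda>\<beta>. ?B (\<beta>(k := Suc (\<beta> k)))) has_sum \<delta> * series_norm s (derivative_coeff k d)) UNIV"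
    unfolding p by (simp add: derivative_coeff_def s abs_mult mult_ac)
  then show "(?B has_sum \<delta> * series_norm s (derivative_coeff k d)) UNIV"
    by (subst (asm) has_sum_raise_index) auto
next
  fix x :: "real^'n" assume x: "x \<in> cube r"
  have m: "((\<lambda>\<alpha>. d \<alpha> * ((\<Prod>i\<in>UNIV - {k}. x $ i ^ \<alpha> i) * t ^ \<alpha> k)) has_sum H (replace_coord k t x)) UNIV"
    if "\<bar>t\<bar> \<le> s" for t
  proof -
    have "replace_coord k t x \<in> cube s" using that x cube_mono[OF r(2)] by (auto simp: cube_iff replace_coord_nth subset_iff)
    then show ?thesis using H by (auto simp: expansion_def monomial_replace_coord)
  qed
  have "((\<lambda>\<alpha>. d \<alpha> * ((\<Prod>i\<in>UNIV - {k}. x $ i ^ \<alpha> i) * \<phi> x ^ \<alpha> k)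
        + - 1 * (d \<alpha> * ((\<Prod>i\<in>UNIV - {k}. x $ i ^ \<alpha> i) * \<psi> x ^ \<alpha> k)))
      has_sum H (replace_coord k (\<phi> x) x) + - 1 * H (replace_coord k (\<psi> x) x)) UNIV"
    by (intro has_sum_add has_sum_cmult_right m) (use expands_bound[OF \<phi> x] expands_bound[OF \<psi> x] in auto)
  then show "((\<lambda>\<alpha>. d \<alpha> * ((\<Prod>i\<in>UNIV - {k}. x $ i ^ \<alpha> i) * (\<phi> x ^ \<alpha> k - \<psi> x ^ \<alpha> k)))
      has_sum H (replace_coord k (\<phi> x) x) - H (replace_coord k (\<psi> x) x)) UNIV"
    by (simp add: algebra_simps)
qed

text \<open>The implicit function is the limit of the iteration of \<open>\<phi> \<mapsto> H(x', \<phi>(x'))\<close>, where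
  \<open>H = x\<^sub>k - G / \<partial>\<^sub>kG(0)\<close>. The Lipschitz constant of this map in the norm of absolutely convergent
  power series is the norm of \<open>\<partial>\<^sub>kH\<close>, which is small on a small cube as \<open>\<partial>\<^sub>kH(0) = 0\<close>.\<close>

lemma fixed_point_expansion:
  fixes H :: "real^'n \<Rightarrow> real"
  assumes H: "expansion R d H" and R: "R > 0" and H0: "H 0 = 0" and d: "d ((\<lambda>_. 0)(k := Suc 0)) = 0"
  obtains \<phi> r s where "0 < r" "r \<le> s" "s \<le> R" "expands r s \<phi>"
    "\<And>x. x \<in> cube r \<Longrightarrow> \<phi> x = H (replace_coord k (\<phi> x) x)"
    "\<And>x a b. x \<in> cube r \<Longrightarrow> \<bar>a\<bar> \<le> s \<Longrightarrow> \<bar>b\<bar> \<le> s \<Longrightarrow>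
       \<bar>H (replace_coord k a x) - H (replace_coord k b x)\<bar> \<le> \<bar>a - b\<bar> / 2"
proof -
  \<comment> \<open>Differentiation needs a strictly smaller radius.\<close>
  define R1 where "R1 = R / 2"
  have R1: "0 < R1" "R1 < R" using R by (auto simp: R1_def)
  have sumd: "(\<lambda>\<beta>. \<bar>derivative_coeff k d \<beta>\<bar> * t ^ index_degree \<beta>) summable_on UNIV" if "0 < t" "t < R" for t
    by (rule derivative_coeff_summable) (use H that in \<open>auto simp: expansion_def\<close>)
  define N where "N = series_norm R1 (derivative_coeff k d)"
  have N: "N \<ge> 0" using R1 by (simp add: N_def series_norm_nonneg)
  \<comment> \<open>The second entry makes \<open>s / R1 * N\<close> at most 1/2, which becomes the
    contraction constant.\<close>
  define s where "s = min R1 (R1 / (2 * (N + 1)))"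
  have s: "0 < s" "s \<le> R1" using R1 N by (auto simp: s_def)
  have "series_norm s (derivative_coeff k d) \<le> s / R1 * N"
    unfolding N_def
    by (rule series_norm_shrink[OF sumd[OF R1]]) (use R1 s d in \<open>auto simp: derivative_coeff_def\<close>)
  also have "\<dots> \<le> 1 / 2"
  proof -
    have "s \<le> R1 / (2 * (N + 1))" by (simp add: s_def)
    then have "s * (2 * (N + 1)) \<le> R1" using N by (simp add: field_simps)
    then have "2 * (s * N) \<le> R1" using s by (simp add: algebra_simps)
    then show ?thesis using R1 by (simp add: field_simps)
  qed
  finally have half: "series_norm s (derivative_coeff k d) \<le> 1 / 2" .
  have Hs: "expansion s d H" using expansion_shrink[OF H] s R1 by auto
  \<comment> \<open>Two radii are in play: \<open>s\<close> limits the values inserted at coordinate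
    \<open>k\<close>, \<open>r\<close> limits the argument. With norm \<open>s / 2\<close> the first
    iterate has size \<open>s / 2\<close>, and halving increments then total at most
    \<open>s\<close>.\<close>
  obtain r where r: "0 < r" "r \<le> s" and Hr: "expands r (s / 2) H"
    using expands_small[OF expansion_imp_expands[OF Hs] H0 s(1), of "s / 2"] s(1)
    by (metis half_gt_zero less_imp_le order_refl)
  have contr: "expands r (\<delta> / 2) (\<lambda>x. H (replace_coord k (\<phi> x) x) - H (replace_coord k (\<psi> x) x))"
    if "expands r s \<phi>" "expands r s \<psi>" "expands r \<delta> (\<lambda>x. \<phi> x - \<psi> x)" for \<phi> \<psi> \<delta>
  proof (rule expands_mono)
    show "expands r (\<delta> * series_norm s (derivative_coeff k d))
      (\<lambda>x. H (replace_coord k (\<phi> x) x) - H (replace_coord k (\<psi> x) x))"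
      by (rule expands_replace_coord_diff[OF Hs sumd]) (use s R1 r that in auto)
    show "\<delta> * series_norm s (derivative_coeff k d) \<le> \<delta> / 2"
      using mult_left_mono[OF half expands_nonneg[OF that(3)]] r by simp
  qed
  \<comment> \<open>Constant functions turn the contraction of series into a pointwise Lipschitz
    bound, from which uniqueness of the solution will follow.\<close>
  have lip: "\<bar>H (replace_coord k a x) - H (replace_coord k b x)\<bar> \<le> \<bar>a - b\<bar> / 2"
    if "x \<in> cube r" "\<bar>a\<bar> \<le> s" "\<bar>b\<bar> \<le> s" for x a b
    using expands_bound[OF contr[of "\<lambda>_. a" "\<lambda>_. b" "\<bar>a - b\<bar>"] that(1)] that
    by (auto intro: expands_mono[OF expands_const] expands_const)
  define ph where "ph j = ((\<lambda>g x. H (replace_coord k (g x) x)) ^^ j) (\<lambda>_. 0)" for j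
  have ph0: "ph 0 = (\<lambda>_. 0)" and phSuc: "ph (Suc j) = (\<lambda>x. H (replace_coord k (ph j x) x))" for j
    by (simp_all add: ph_def)
  \<comment> \<open>The bound on the iterate is a partial sum of the geometric increments; staying
    below \<open>s\<close> keeps the contraction estimate applicable.\<close>
  have ph: "expands r (s * (1 - (1 / 2) ^ j)) (ph j) \<and>
      expands r (s * (1 / 2) ^ Suc j) (\<lambda>x. ph (Suc j) x - ph j x)" for j
  proof (induction j)
    case 0
    have "expands r r (\<lambda>x. replace_coord k 0 x $ i)" for i
      using r by (intro expands_replace_coord) auto
    then have "expands r (s / 2) (\<lambda>x. H (replace_coord k 0 x))" using r by (intro expands_compose[OF Hr]) auto
    then show ?case using expands_const[of r 0] by (simp add: ph0 phSuc)
  next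
    case (Suc j)
    have le: "s * (1 - (1 / 2) ^ i) \<le> s" for i :: nat using s by (simp add: mult_le_cancel_left1)
    have "expands r (s * (1 - (1 / 2) ^ j) + s * (1 / 2) ^ Suc j) (\<lambda>x. ph j x + (ph (Suc j) x - ph j x))"
      using Suc r by (intro expands_add) auto
    then have 1: "expands r (s * (1 - (1 / 2) ^ Suc j)) (ph (Suc j))" by (simp add: algebra_simps)
    have "expands r (s * (1 / 2) ^ Suc j / 2)
      (\<lambda>x. H (replace_coord k (ph (Suc j) x) x) - H (replace_coord k (ph j x) x))"
      by (rule contr) (use Suc 1 le expands_mono in blast)+
    then show ?case using 1 by (simp only: phSuc power_Suc) (simp add: mult_ac)
  qed
  have ph_bound: "\<bar>ph j x\<bar> \<le> s" if "x \<in> cube r" for j x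
  proof -
    have "s * (1 - (1 / 2) ^ j) \<le> s" using s by (simp add: mult_le_cancel_left1)
    then show ?thesis using expands_bound[OF conjunct1[OF ph] that, of j] by linarith
  qed
  have geo: "(\<lambda>j. s * (1 / 2) ^ Suc j) sums s"
    using sums_mult[OF geometric_sums[of "1 / 2 :: real"], of "s / 2"] by (simp add: mult_ac)
  define \<phi> where "\<phi> x = (\<Sum>j. ph (Suc j) x - ph j x)" for x
  have norms: "summable (\<lambda>j. norm (ph (Suc j) x - ph j x))" if "x \<in> cube r" for x
    by (rule summable_comparison_test'[OF sums_summable[OF geo], of 0])
      (use expands_bound[OF conjunct2[OF ph] that] in auto)
  have \<phi>: "expands r s \<phi>"
  proof (rule expands_has_sum[where J = UNIV])
    show "expands r (s * (1 / 2) ^ Suc j) (\<lambda>x. ph (Suc j) x - ph j x)" for j using ph by blast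
    show "((\<lambda>j. s * (1 / 2) ^ Suc j) has_sum s) UNIV"
      using geo by (rule sums_nonneg_imp_has_sum) (use s in simp)
    show "((\<lambda>j. ph (Suc j) x - ph j x) has_sum \<phi> x) UNIV" if "x \<in> cube r" for x
      unfolding \<phi>_def
      by (rule norm_summable_imp_has_sum[OF norms summable_sums[OF summable_norm_cancel[OF norms]]])
        (fact that)+
  qed (use r in auto)
  have lim: "(\<lambda>j. ph j x) \<longlonglongrightarrow> \<phi> x" if "x \<in> cube r" for x
  proof -
    have "(\<lambda>j. ph (Suc j) x - ph j x) sums \<phi> x"
      unfolding \<phi>_def by (rule summable_sums[OF summable_norm_cancel[OF norms[OF that]]])
    then show ?thesis unfolding sums_def using sum_lessThan_telescope[of "\<lambda>j. ph j x"] by (simp add: ph0)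
  qed
  have fixp: "\<phi> x = H (replace_coord k (\<phi> x) x)" if x: "x \<in> cube r" for x
  proof -
    have "(\<lambda>j. \<bar>ph j x - \<phi> x\<bar> / 2) \<longlonglongrightarrow> \<bar>\<phi> x - \<phi> x\<bar> / 2"
      by (intro tendsto_intros lim[OF x]) auto
    then have half0: "(\<lambda>j. \<bar>ph j x - \<phi> x\<bar> / 2) \<longlonglongrightarrow> 0" by simp
    have "norm (H (replace_coord k (ph j x) x) - H (replace_coord k (\<phi> x) x))
        \<le> \<bar>ph j x - \<phi> x\<bar> / 2" for j
      using lip[OF x ph_bound[OF x] expands_bound[OF \<phi> x]] by simp
    then have "(\<lambda>j. H (replace_coord k (ph j x) x) - H (replace_coord k (\<phi> x) x)) \<longlonglongrightarrow> 0"
      by (intro Lim_null_comparison[OF always_eventually half0]) simp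
    then have "(\<lambda>j. ph (Suc j) x) \<longlonglongrightarrow> H (replace_coord k (\<phi> x) x)"
      by (simp add: phSuc LIM_zero_iff)
    then show ?thesis using LIMSEQ_Suc[OF lim[OF x]] LIMSEQ_unique by blast
  qed
  show ?thesis by (rule that[OF r(1,2) _ \<phi> fixp lip]) (use s R1 in auto)
qed

text \<open>\<open>G x = 0\<close> says that \<open>x $ k\<close> is a fixed point of the
  contraction at \<open>x\<close>, as is \<open>\<phi> x\<close>; two fixed points at distance at
  most half their distance coincide. A function of the other coordinates is represented on the full
  space by its invariance under \<open>replace_coord k\<close>.\<close>

lemma implicit_function_expansion:
  fixes G :: "real^'n \<Rightarrow> real"
  assumes G: "expansion R c G" and R: "R > 0" and G0: "G 0 = 0" and c: "c ((\<lambda>_. 0)(k := Suc 0)) \<noteq> 0"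
  obtains \<phi> r where "0 < r" "r \<le> R" "expands r R \<phi>" "\<And>x t. \<phi> (replace_coord k t x) = \<phi> x"
    "\<And>x. x \<in> cube r \<Longrightarrow> G x = 0 \<Longrightarrow> x $ k = \<phi> x"
proof -
  define u :: "'n \<Rightarrow> nat" where "u = (\<lambda>_. 0)(k := Suc 0)"
  define d where "d \<alpha> = (if \<alpha> = u then 1 else 0) - c \<alpha> / c u" for \<alpha>
  define H where "H x = x $ k - G x / c u" for x
  have u: "monomial x u = x $ k" for x :: "real^'n"
    unfolding u_def using monomial_upd[of x "\<lambda>_. 0" k] by (simp add: monomial_0)
  have H: "expansion R d H"
    unfolding expansion_def
  proof (intro conjI ballI)
    have s1: "(\<lambda>\<alpha>. if \<alpha> = u then R ^ index_degree \<alpha> else 0) summable_on UNIV"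
      by (rule finite_nonzero_values_imp_summable_on) auto
    have s2: "(\<lambda>\<alpha>. \<bar>c \<alpha>\<bar> * R ^ index_degree \<alpha> * (1 / \<bar>c u\<bar>)) summable_on UNIV"
      using G by (intro summable_on_cmult_left) (auto simp: expansion_def)
    show "(\<lambda>\<alpha>. \<bar>d \<alpha>\<bar> * R ^ index_degree \<alpha>) summable_on UNIV"
    proof (rule summable_on_comparison_test[OF summable_on_add[OF s1 s2]])
      fix \<alpha> :: "'n \<Rightarrow> nat"
      have "\<bar>d \<alpha>\<bar> \<le> (if \<alpha> = u then 1 else 0) + \<bar>c \<alpha>\<bar> / \<bar>c u\<bar>"
        unfolding d_def using abs_triangle_ineq4[of "if \<alpha> = u then 1 else 0" "c \<alpha> / c u"]
        by (simp add: abs_divide split: if_splits)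
      from mult_right_mono[OF this, of "R ^ index_degree \<alpha>"]
      show "\<bar>d \<alpha>\<bar> * R ^ index_degree \<alpha> \<le>
          (if \<alpha> = u then R ^ index_degree \<alpha> else 0) + \<bar>c \<alpha>\<bar> * R ^ index_degree \<alpha> * (1 / \<bar>c u\<bar>)"
        using R by (auto simp: algebra_simps)
    qed (use R in auto)
    fix x :: "real^'n" assume "x \<in> cube R"
    then have "((\<lambda>\<alpha>. c \<alpha> * monomial x \<alpha> * (- 1 / c u)) has_sum G x * (- 1 / c u)) UNIV"
      using G by (intro has_sum_cmult_left) (auto simp: expansion_def)
    moreover have "((\<lambda>\<alpha>. (if \<alpha> = u then 1 else 0) * monomial x \<alpha>) has_sum x $ k) UNIV"
      by (rule has_sum_finite_neutralI[of "{u}"]) (auto simp: u)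
    ultimately have "((\<lambda>\<alpha>. (if \<alpha> = u then 1 else 0) * monomial x \<alpha> + c \<alpha> * monomial x \<alpha> * (- 1 / c u))
        has_sum x $ k + G x * (- 1 / c u)) UNIV"
      by (rule has_sum_add[rotated])
    then show "((\<lambda>\<alpha>. d \<alpha> * monomial x \<alpha>) has_sum H x) UNIV"
      by (simp add: d_def H_def algebra_simps)
  qed
  have "d u = 0" using c by (simp add: d_def u_def)
  with fixed_point_expansion[OF H R, of k] obtain \<psi> r s where r: "0 < r" "r \<le> s" "s \<le> R"
    and \<psi>: "expands r s \<psi>"
    and fixp: "\<And>x. x \<in> cube r \<Longrightarrow> \<psi> x = H (replace_coord k (\<psi> x) x)"
    and lip: "\<And>x a b. x \<in> cube r \<Longrightarrow> \<bar>a\<bar> \<le> s \<Longrightarrow> \<bar>b\<bar> \<le> s \<Longrightarrow>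
       \<bar>H (replace_coord k a x) - H (replace_coord k b x)\<bar> \<le> \<bar>a - b\<bar> / 2"
    by (metis H_def G0 u_def zero_index diff_zero div_0)
  \<comment> \<open>Erasing coordinate \<open>k\<close> first makes the invariance hold by
    construction, also outside the cube.\<close>
  define \<phi> where "\<phi> x = \<psi> (replace_coord k 0 x)" for x
  have rc: "replace_coord k 0 x \<in> cube r" if "x \<in> cube r" for x
    using that r by (auto simp: cube_iff replace_coord_nth)
  have "expands r r (\<lambda>x. replace_coord k 0 x $ i)" for i
    using r by (intro expands_replace_coord) auto
  then have "expands r s \<phi>" unfolding \<phi>_def using r by (intro expands_compose[OF \<psi>]) auto
  then have \<phi>: "expands r R \<phi>" using r expands_mono by blast
  have "x $ k = \<phi> x" if x: "x \<in> cube r" and "G x = 0" for x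
  proof -
    have "H (replace_coord k (x $ k) x) = x $ k" using that by (simp add: replace_coord_self H_def)
    moreover have "H (replace_coord k (\<phi> x) x) = \<phi> x"
      using fixp[OF rc[OF x]] by (simp add: \<phi>_def replace_coord_replace)
    moreover have "\<bar>x $ k\<bar> \<le> s" using x r order_trans unfolding cube_iff by blast
    moreover have "\<bar>\<phi> x\<bar> \<le> s" unfolding \<phi>_def by (rule expands_bound[OF \<psi> rc[OF x]])
    ultimately show ?thesis using lip[OF x, of "x $ k" "\<phi> x"] by auto
  qed
  moreover have "\<phi> (replace_coord k t x) = \<phi> x" for t x by (simp add: \<phi>_def replace_coord_replace)
  ultimately show ?thesis using that[of r \<phi>] r \<phi> by auto
qed

section \<open>Maxima with non-vanishing Hessian\<close>

lemma series_value_0: "series_value c 0 = c (\<lambda>_. 0)"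
  unfolding series_value_def
  by (intro infsumI has_sum_finite_neutralI[of "{\<lambda>_. 0}"]) (auto simp: monomial_at_0)

text \<open>A positive derivative of \<open>g\<close> at its zero makes \<open>g\<close> positive
  just to the right of 0, so \<open>v\<close> strictly increases there.\<close>

lemma exceeds_of_second_derivative_pos:
  fixes v g :: "real \<Rightarrow> real"
  assumes e: "e > 0" and v: "\<And>t. \<bar>t\<bar> < e \<Longrightarrow> (v has_real_derivative g t) (at t)"
    and g: "(g has_real_derivative D) (at 0)" and "g 0 = 0" "D > 0"
  obtains t where "0 < t" "t < e" "v t > v 0"
proof -
  obtain d where d: "d > 0" "\<And>h. 0 < h \<Longrightarrow> h < d \<Longrightarrow> g 0 < g (0 + h)"
    using DERIV_pos_inc_right[OF g \<open>D > 0\<close>] by blast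
  define t where "t = min d e / 2"
  have t: "0 < t" "t < e" "t < d" using e d by (auto simp: t_def)
  have "v 0 < v t"
  proof (rule DERIV_pos_imp_increasing_open[OF t(1)])
    fix x assume "0 < x" "x < t"
    then show "\<exists>y. (v has_real_derivative y) (at x) \<and> 0 < y"
      using v[of x] d(2)[of x] t \<open>g 0 = 0\<close> by (intro exI[of _ "g x"]) auto
  next
    show "continuous_on {0..t} v"
      by (intro continuous_at_imp_continuous_on ballI DERIV_isCont[OF v]) (use t in auto)
  qed
  with t show ?thesis by (intro that)
qed

lemma open_cube_around: "open {x::real^'n. \<forall>i. \<bar>x $ i - a $ i\<bar> < r}"
proof -
  have "{x::real^'n. \<forall>i. \<bar>x $ i - a $ i\<bar> < r} = box (\<chi> i. a $ i - r) (\<chi> i. a $ i + r)"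
    by (auto simp: mem_box_cart abs_diff_less_iff)
  then show ?thesis by (simp add: open_box)
qed

lemma expansion_gradient_at_max:
  fixes F :: "real^'n \<Rightarrow> real"
  assumes F: "expansion R a F" and max: "\<And>y. y \<in> cube R \<Longrightarrow> F y \<le> F x" and x: "\<And>i. \<bar>x $ i\<bar> < R"
  shows "series_value (derivative_coeff k a) x = 0"
proof -
  define m where "m = Max (range (\<lambda>i. \<bar>x $ i\<bar>))"
  have m: "\<bar>x $ i\<bar> \<le> m" for i unfolding m_def by (intro Max_ge) auto
  have "m \<in> range (\<lambda>i. \<bar>x $ i\<bar>)" unfolding m_def by (intro Max_in) auto
  then have "0 \<le> m" "m < R" using x by auto
  \<comment> \<open>\<open>m\<close> is the sup norm of \<open>x\<close>; the midpoint of
    \<open>m\<close> and \<open>R\<close> leaves \<open>x\<close> strictly inside a smaller cube, as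
    differentiation requires.\<close>
  define r where "r = (m + R) / 2"
  have r: "0 < r" "r < R" "m < r" using \<open>0 \<le> m\<close> \<open>m < R\<close> by (auto simp: r_def)
  have "(F has_derivative (\<lambda>v. \<Sum>k\<in>UNIV. series_value (derivative_coeff k a) x * v $ k)) (at x)"
    using m r by (intro expansion_has_derivative[OF F r(1,2)]) (meson le_less_trans)
  moreover have "open {y::real^'n. \<forall>i. \<bar>y $ i\<bar> < R}" using open_cube_around[of 0 R] by simp
  moreover have "F y \<le> F x" if "\<forall>i. \<bar>y $ i\<bar> < R" for y
    using that by (intro max) (auto simp: cube_iff intro: less_imp_le)
  ultimately have "(\<lambda>v::real^'n. \<Sum>k\<in>UNIV. series_value (derivative_coeff k a) x * v $ k) = (\<lambda>v. 0)"
    using x by (intro differential_zero_maxmin[of x "{y. \<forall>i. \<bar>y $ i\<bar> < R}" F]) auto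
  from fun_cong[OF this, of "axis k 1"] show ?thesis
    by (simp add: axis_def if_distrib cong: if_cong)
qed

text \<open>A negative semidefinite symmetric matrix with zero diagonal vanishes.\<close>

lemma diagonal_second_derivative_nonzero:
  fixes F :: "real^'n \<Rightarrow> real"
  assumes F: "expansion R a F" and R: "R > 0" and max: "\<And>y. y \<in> cube R \<Longrightarrow> F y \<le> F 0"
    and nz: "derivative_coeff i (derivative_coeff j a) (\<lambda>_. 0) \<noteq> 0"
  obtains k where "derivative_coeff k (derivative_coeff k a) (\<lambda>_. 0) \<noteq> 0"
proof (rule ccontr)
  assume "\<not> thesis"
  then have diag: "derivative_coeff k (derivative_coeff k a) (\<lambda>_. 0) = 0" for k using that by blast
  then have "i \<noteq> j" using nz by auto
  define b where "b = derivative_coeff i (derivative_coeff j a) (\<lambda>_. 0)"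
  \<comment> \<open>With vanishing diagonal the second derivative along \<open>w\<close> is twice
    \<sigma> times the mixed entry \<open>b\<close>. The sign makes this
    \<open>2 * \<bar>b\<bar> > 0\<close>, so \<open>F\<close> would exceed its maximum on this
    line.\<close>
  define \<sigma> where "\<sigma> = sgn b"
  define w :: "real^'n" where "w = axis i 1 + \<sigma> *\<^sub>R axis j 1"
  have w_nth: "w $ k = (if k = i then 1 else 0) + (if k = j then \<sigma> else 0)" for k
    by (simp add: w_def axis_def)
  have wsum: "(\<Sum>k\<in>UNIV. s k * w $ k) = s i + \<sigma> * s j" for s :: "'n \<Rightarrow> real"
  proof -
    have "(\<Sum>k\<in>UNIV. s k * w $ k)
        = (\<Sum>k\<in>UNIV. (if k = i then s k else 0) + (if k = j then \<sigma> * s k else 0))"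
      by (intro sum.cong) (auto simp: w_nth algebra_simps)
    then show ?thesis by (simp add: sum.distrib)
  qed
  have w1: "\<bar>w $ k\<bar> \<le> 1" for k using \<open>i \<noteq> j\<close> by (auto simp: w_nth \<sigma>_def sgn_if)
  have r: "0 < R / 2" "R / 2 < R" "0 < R / 4" "R / 4 < R / 2" using R by auto
  have cs: "(\<lambda>\<alpha>. \<bar>a \<alpha>\<bar> * R ^ index_degree \<alpha>) summable_on UNIV" using F by (simp add: expansion_def)
  have dG: "expansion (R / 2) (derivative_coeff k a) (series_value (derivative_coeff k a))" for k
    by (intro expansion_series_value derivative_coeff_summable[OF cs r(1,2)])
  define G where "G k = series_value (derivative_coeff k a)" for k
  define g where "g t = G i (t *\<^sub>R w) + \<sigma> * G j (t *\<^sub>R w)" for t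
  have line: "((\<lambda>t. t *\<^sub>R w) has_derivative (\<lambda>h. h *\<^sub>R w)) (at t)" for t
    by (auto intro!: derivative_eq_intros)
  have chain: "((\<lambda>t. h (t *\<^sub>R w)) has_real_derivative D i + \<sigma> * D j) (at t)"
    if "(h has_derivative (\<lambda>v. \<Sum>k\<in>UNIV. D k * v $ k)) (at (t *\<^sub>R w))" for h D t
  proof -
    have "((\<lambda>t. h (t *\<^sub>R w)) has_derivative (\<lambda>s. \<Sum>k\<in>UNIV. D k * (s *\<^sub>R w) $ k)) (at t)"
      by (rule has_derivative_compose[OF line that])
    moreover have "(\<lambda>s. \<Sum>k\<in>UNIV. D k * (s *\<^sub>R w) $ k) = (*) (D i + \<sigma> * D j)"
      using wsum[of D] by (auto simp: fun_eq_iff mult_ac sum_distrib_left[symmetric])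
    ultimately show ?thesis by (simp add: has_field_derivative_def)
  qed
  have small: "\<bar>(t *\<^sub>R w) $ k\<bar> < q" if "\<bar>t\<bar> < q" for t q k
    using mult_mono[OF order_refl w1[of k], of "\<bar>t\<bar>"] that by (simp add: abs_mult)
  have "((\<lambda>t. F (t *\<^sub>R w)) has_real_derivative g t) (at t)" if "\<bar>t\<bar> < R / 2" for t
    unfolding g_def G_def
    by (intro chain expansion_has_derivative[OF F r(1,2)] small that)
  moreover have "(g has_real_derivative 2 * \<bar>b\<bar>) (at 0)"
  proof -
    have "((\<lambda>t. G k (t *\<^sub>R w)) has_real_derivative
        derivative_coeff i (derivative_coeff k a) (\<lambda>_. 0) + \<sigma> * derivative_coeff j (derivative_coeff k a) (\<lambda>_. 0)) (at 0)" for k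
      unfolding G_def series_value_0[symmetric]
      using expansion_has_derivative[OF dG r(3,4), of "0 *\<^sub>R w"] r
      by (intro chain) auto
    from DERIV_add[OF this[of i] DERIV_cmult[OF this[of j], of \<sigma>]]
    show ?thesis using nz
      by (simp add: g_def[abs_def] diag derivative_coeff_commute[of j i] b_def[symmetric] \<sigma>_def
          sgn_if split: if_splits)
  qed
  moreover have "g 0 = 0"
    using expansion_gradient_at_max[OF F max, of _ ] R by (simp add: g_def G_def)
  ultimately obtain t where t: "0 < t" "t < R / 2" "F (t *\<^sub>R w) > F (0 *\<^sub>R w)"
    using exceeds_of_second_derivative_pos[of "R / 2" "\<lambda>t. F (t *\<^sub>R w)" g "2 * \<bar>b\<bar>"] r nz
    unfolding b_def by auto
  have "\<bar>(t *\<^sub>R w) $ k\<bar> \<le> R" for k using small[of t "R / 2" k] t r by linarith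
  then have "t *\<^sub>R w \<in> cube R" by (simp add: cube_iff)
  from max[OF this] t show False by simp
qed

lemma maximum_set_in_graph:
  fixes F :: "real^'n \<Rightarrow> real"
  assumes F: "expansion R a F" and R: "R > 0" and max: "\<And>y. y \<in> cube R \<Longrightarrow> F y \<le> F 0"
    and nz: "derivative_coeff i (derivative_coeff j a) (\<lambda>_. 0) \<noteq> 0"
  obtains k \<phi> r where "0 < r" "r < R" "expands r R \<phi>" "\<And>x t. \<phi> (replace_coord k t x) = \<phi> x"
    "\<And>x. x \<in> cube r \<Longrightarrow> F x = F 0 \<Longrightarrow> x $ k = \<phi> x"
proof -
  obtain k where k: "derivative_coeff k (derivative_coeff k a) (\<lambda>_. 0) \<noteq> 0"
    by (rule diagonal_second_derivative_nonzero[OF F R max nz])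
  have r: "0 < R / 2" "R / 2 < R" using R by auto
  define G where "G = series_value (derivative_coeff k a)"
  have G: "expansion (R / 2) (derivative_coeff k a) G"
    unfolding G_def using F
    by (intro expansion_series_value derivative_coeff_summable[OF _ r]) (simp add: expansion_def)
  \<comment> \<open>\<open>F x = F 0\<close> makes \<open>x\<close> itself a maximum over the cube,
    so the gradient vanishes at \<open>x\<close> and not merely at the centre.\<close>
  have crit: "G x = 0" if "x \<in> cube (R / 2)" "F x = F 0" for x
    unfolding G_def
  proof (rule expansion_gradient_at_max[OF F])
    show "\<bar>x $ i\<bar> < R" for i using that(1) r(2) unfolding cube_iff by (meson le_less_trans)
  qed (use max that in auto)
  have G0: "G 0 = 0" using crit[of 0] r by (simp add: cube_iff)
  \<comment> \<open>At index 0 the factor in \<open>derivative_coeff\<close> is 1, so the diagonal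
    entry is the linear coefficient of \<open>G\<close> in coordinate \<open>k\<close>.\<close>
  have c: "derivative_coeff k a ((\<lambda>_. 0)(k := Suc 0)) \<noteq> 0"
    using k by (simp add: derivative_coeff_def)
  obtain \<phi> r where \<phi>: "0 < r" "r \<le> R / 2" "expands r (R / 2) \<phi>" "\<And>x t. \<phi> (replace_coord k t x) = \<phi> x"
    "\<And>x. x \<in> cube r \<Longrightarrow> G x = 0 \<Longrightarrow> x $ k = \<phi> x"
    by (rule implicit_function_expansion[OF G r(1) G0 c]) (rule that)
  show ?thesis
  proof (rule that[of r \<phi> k])
    show "r < R" using \<phi> R by simp
    show "expands r R \<phi>" using \<phi>(3) R by (intro expands_mono[OF \<phi>(3)]) auto
    show "x $ k = \<phi> x" if "x \<in> cube r" "F x = F 0" for x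
      using \<phi>(5)[OF that(1) crit] that cube_mono[OF \<phi>(2)] by auto
  qed (use \<phi> in auto)
qed

text \<open>Re-expansion about \<open>y1\<close> with radius \<open>r / 2\<close> stays inside the
  cube of radius \<open>r\<close>, and it reaches all of the cube of radius \<open>r / 4\<close>,
  since two of its points differ by at most \<open>r / 2\<close> in each coordinate.\<close>

lemma expands_vanishing_propagates:
  fixes u :: "real^'n \<Rightarrow> real"
  assumes u: "expands r B u" and r: "r > 0" and y1: "\<And>i. \<bar>y1 $ i\<bar> < r / 4"
    and z: "eventually (\<lambda>y. u y = 0) (nhds y1)" and y: "y \<in> cube (r / 4)"
  shows "u y = 0"
proof -
  have "expands (r / 2) B (\<lambda>y. u (y1 + y))"
  proof (rule expands_shift[OF u])
    show "\<bar>y1 $ i\<bar> + r / 2 \<le> r" for i using y1[of i] r by linarith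
  qed (use r in simp)
  moreover have "eventually (\<lambda>y. u (y1 + y) = 0) (nhds 0)"
  proof -
    have "((\<lambda>y. y1 + y) \<longlongrightarrow> y1) (nhds 0)"
      using tendsto_add[OF tendsto_const[of y1] filterlim_ident[of "nhds 0"]] by simp
    then show ?thesis using z by (rule eventually_compose_filterlim[rotated])
  qed
  moreover have "\<bar>y $ i - y1 $ i\<bar> \<le> r / 2" for i
  proof -
    have "\<bar>y $ i\<bar> \<le> r / 4" "\<bar>y1 $ i\<bar> \<le> r / 4" using y y1[of i] by (auto simp: cube_iff)
    then show ?thesis by linarith
  qed
  ultimately have "u (y1 + (y - y1)) = 0"
    using r by (intro expands_identity[of "r / 2" B "\<lambda>y. u (y1 + y)"]) (auto simp: cube_iff)
  then show ?thesis by simp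
qed

text \<open>At interior points of \<open>S\<close> the derivative within \<open>S\<close> is the
  full derivative, which ties the coordinate derivatives of the definitions to formal ones.\<close>

lemma partial_deriv_expansion:
  fixes H :: "real^'n \<Rightarrow> real"
  assumes h: "expansion R c h" and H: "\<And>y. y \<in> cube R \<Longrightarrow> H (x0 + y) = h y"
    and S: "\<And>y. y \<in> cube R \<Longrightarrow> x0 + y \<in> interior S" and r: "0 < r" "r < R"
    and y: "\<And>i. \<bar>y $ i\<bar> < r"
  shows "partial_deriv S j H (x0 + y) = series_value (derivative_coeff j c) y"
proof -
  define D where "D v = (\<Sum>k\<in>UNIV. series_value (derivative_coeff k c) y * v $ k)" for v
  define U where "U = {x. \<forall>i. \<bar>x $ i - x0 $ i\<bar> < r}"
  have U: "open U" "x0 + y \<in> U" using y open_cube_around by (auto simp: U_def)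
  have UR: "x - x0 \<in> cube R" if "x \<in> U" for x
    using that r(2) unfolding U_def cube_iff by (auto intro: less_imp_le order_less_trans)
  have "(h has_derivative D) (at y)"
    unfolding D_def by (rule expansion_has_derivative[OF h r y])
  moreover have "((\<lambda>x. x - x0) has_derivative (\<lambda>v. v)) (at (x0 + y))"
    by (auto intro!: derivative_eq_intros)
  ultimately have "((\<lambda>x. h (x - x0)) has_derivative D) (at (x0 + y))"
    using has_derivative_compose[of "\<lambda>x. x - x0" "\<lambda>v. v" "x0 + y" UNIV h D] by simp
  then have "(H has_derivative D) (at (x0 + y))"
    by (rule has_derivative_transform_within_open[OF _ U]) (use H[OF UR] in auto)
  moreover have "at (x0 + y) within S = at (x0 + y)"
    using UR[OF U(2)] by (intro at_within_interior S) simp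
  ultimately have "frechet_derivative H (at (x0 + y) within S) = D"
    by (metis frechet_derivative_at)
  then show ?thesis
    by (simp add: partial_deriv_def D_def axis_def if_distrib cong: if_cong)
qed

lemma real_analytic_on_continuous_on:
  assumes "h real_analytic_on S"
  shows "continuous_on S h"
  unfolding continuous_on_def
proof
  fix x0 assume x0: "x0 \<in> S"
  obtain k r B where r: "r > 0" and k: "expands r B (\<lambda>y. k (x0 + y))"
    and kh: "\<And>x. x \<in> S \<Longrightarrow> x - x0 \<in> cube r \<Longrightarrow> k x = h x"
    using assms x0 unfolding real_analytic_on_iff by blast
  obtain c where c: "expansion r c (\<lambda>y. k (x0 + y))" using k by (auto simp: expands_def)
  have "isCont (\<lambda>y. k (x0 + y)) 0"
    using r by (intro has_derivative_continuous[OF expansion_has_derivative[OF c, of "r / 2"]]) auto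
  moreover have "((\<lambda>x. x - x0) \<longlongrightarrow> 0) (at x0 within S)"
    by (auto intro!: tendsto_eq_intros)
  ultimately have "((\<lambda>x. k (x0 + (x - x0))) \<longlongrightarrow> k (x0 + 0)) (at x0 within S)"
    by (rule isCont_tendsto_compose)
  then have "(k \<longlongrightarrow> h x0) (at x0 within S)" using kh[OF x0] r by (simp add: cube_iff)
  moreover have "eventually (\<lambda>x. k x = h x) (at x0 within S)"
    unfolding eventually_at
  proof (intro exI[of _ r] conjI ballI impI)
    fix x assume x: "x \<in> S" "x \<noteq> x0 \<and> dist x x0 < r"
    then have "x - x0 \<in> cube r"
      using component_le_norm_cart[of "x - x0"] unfolding cube_iff dist_norm
      by (meson less_imp_le order_trans)
    then show "k x = h x" using kh x by blast
  qed (fact r)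
  ultimately show "(h \<longlongrightarrow> h x0) (at x0 within S)" by (rule Lim_transform_eventually)
qed

section \<open>Charts and the top stratum\<close>

lemma open_contains_offset_cube:
  fixes x0 :: "real^'n"
  assumes "open U" "x0 \<in> U"
  obtains R where "R > 0" "\<And>y. y \<in> cube R \<Longrightarrow> x0 + y \<in> U"
proof -
  obtain e where e: "e > 0" "ball x0 e \<subseteq> U" using assms open_contains_ball by blast
  define R where "R = e / (real CARD('n) + 1)"
  have R: "R > 0" using e by (simp add: R_def)
  have "x0 + y \<in> U" if "y \<in> cube R" for y
  proof -
    have "norm y \<le> (\<Sum>i\<in>UNIV. \<bar>y $ i\<bar>)" by (rule norm_le_l1_cart)
    also have "\<dots> \<le> (\<Sum>i\<in>(UNIV :: 'n set). R)" using that by (intro sum_mono) (simp add: cube_iff)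
    also have "\<dots> < e" using e by (simp add: R_def field_simps)
    finally show ?thesis using e(2) by (auto simp: dist_norm)
  qed
  with R show ?thesis by (rule that)
qed

lemma continuous_on_replace_coord:
  fixes h :: "'b::topological_space \<Rightarrow> real^'n"
  assumes "continuous_on S h"
  shows "continuous_on S (\<lambda>x. replace_coord k t (h x))"
proof -
  have "replace_coord k t y = y + (t - y $ k) *\<^sub>R axis k 1" for y :: "real^'n"
    by (simp add: vec_eq_iff replace_coord_nth axis_def)
  then show ?thesis using assms by (auto intro!: continuous_intros)
qed

lemma chart_inv_coord: "is_chart c \<Longrightarrow> q \<in> fst c \<Longrightarrow> chart_inv c (snd c q) = q"
  by (simp add: is_chart_def)

lemma is_chart_continuous:
  assumes "is_chart c"
  shows "continuous_on (fst c) (snd c)" "continuous_on (chart_range c) (chart_inv c)"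
  using assms by (auto simp: is_chart_def homeomorphism_def)

lemma is_chart_open_image:
  assumes c: "is_chart c" and "open U" "U \<subseteq> fst c"
  shows "openin (top_of_set (chart_range c)) (snd c ` U)"
proof (rule homeomorphism_imp_open_map)
  show "homeomorphism (fst c) (chart_range c) (snd c) (chart_inv c)" using c by (simp add: is_chart_def)
  show "openin (top_of_set (fst c)) U"
    using assms by (metis inf.absorb_iff2 openin_open)
qed

lemma chart_interior:
  fixes A :: "('a::topological_space, 'n::finite) chart set"
  assumes c: "is_chart c" "c \<in> A" and p: "p \<in> fst c" "p \<notin> manifold_boundary A"
  shows "snd c p \<in> interior (chart_range c)"
proof (cases "open (chart_range c)")
  case True
  then show ?thesis using p by (simp add: interior_open)
next
  case False
  then obtain k where k: "openin (top_of_set (half_space k)) (chart_range c)"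
    using c by (auto simp: is_chart_def)
  then obtain T where T: "open T" "chart_range c = half_space k \<inter> T" by (auto simp: openin_open)
  have "snd c p $ k \<noteq> 0" using k c p unfolding manifold_boundary_def by blast
  moreover have mem: "snd c p \<in> half_space k \<inter> T" using T(2) p(1) by blast
  ultimately have "snd c p \<in> T \<inter> {x. x $ k > 0}" by (auto simp: half_space_def)
  moreover have "open (T \<inter> {x. x $ k > 0})"
    using T(1) by (intro open_Int open_halfspace_component_gt_cart)
  moreover have "T \<inter> {x. x $ k > 0} \<subseteq> chart_range c" using T(2) by (auto simp: half_space_def)
  ultimately show ?thesis by (meson interiorI)
qed

text \<open>Transitions from the new chart are old transitions after \<Psi>', those into it are
  \<Psi> after old transitions. Using one open set \<open>P\<close> preserved by both maps avoids
  describing the image of \<open>W\<close>, whose openness follows by writing it as a preimage under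
  \<Psi>'.\<close>

lemma recoordinatized_chart_in_max_atlas:
  fixes A :: "('a::{t2_space, second_countable_topology}, 'n::finite) chart set"
  assumes A: "real_analytic_atlas A" and c: "c \<in> A" and W: "open W" "W \<subseteq> fst c"
    and P: "open P" "snd c ` W \<subseteq> P" and V: "open (snd c ` W)"
    and \<Psi>: "\<And>x. x \<in> P \<Longrightarrow> \<Psi> x \<in> P" "\<And>x. x \<in> P \<Longrightarrow> \<Psi>' (\<Psi> x) = x"
    and \<Psi>': "\<And>x. x \<in> P \<Longrightarrow> \<Psi>' x \<in> P" "\<And>x. x \<in> P \<Longrightarrow> \<Psi> (\<Psi>' x) = x"
    and an: "\<And>i. (\<lambda>x. \<Psi> x $ i) real_analytic_on P" "\<And>i. (\<lambda>x. \<Psi>' x $ i) real_analytic_on P"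
  shows "(W, \<Psi> \<circ> snd c) \<in> max_atlas A" "open ((\<Psi> \<circ> snd c) ` W)"
proof -
  define e where "e = (W, \<Psi> \<circ> snd c)"
  have c1: "is_chart c" and comp: "\<And>d. d \<in> A \<Longrightarrow> analytic_compatible c d"
    using A c by (auto simp: real_analytic_atlas_def)
  have cinv: "chart_inv c (snd c q) = q" if "q \<in> W" for q
    using chart_inv_coord[OF c1] that W by auto
  have WP: "snd c q \<in> P" if "q \<in> W" for q using that P by auto
  have cont: "continuous_on P \<Psi>" "continuous_on P \<Psi>'"
    using continuous_on_vec_lambda[of P "\<lambda>i x. \<Psi> x $ i"] continuous_on_vec_lambda[of P "\<lambda>i x. \<Psi>' x $ i"]
      real_analytic_on_continuous_on[OF an(1)] real_analytic_on_continuous_on[OF an(2)]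
    by simp_all
  have "(\<Psi> \<circ> snd c) ` W = P \<inter> \<Psi>' -` (snd c ` W)"
  proof (intro equalityI subsetI)
    fix x assume "x \<in> P \<inter> \<Psi>' -` (snd c ` W)"
    then obtain q where "q \<in> W" "\<Psi>' x = snd c q" "x \<in> P" by auto
    then show "x \<in> (\<Psi> \<circ> snd c) ` W" using \<Psi>'(2)[of x] by (metis comp_apply imageI)
  qed (use \<Psi> WP in auto)
  moreover have "open (P \<inter> \<Psi>' -` (snd c ` W))"
    by (rule continuous_open_preimage[OF cont(2) P(1) V])
  ultimately show op: "open ((\<Psi> \<circ> snd c) ` W)" by simp
  have inv: "\<Psi>' ((\<Psi> \<circ> snd c) q) = snd c q" if "q \<in> W" for q
    using \<Psi>(2) WP[OF that] by simp
  have inj: "inj_on (\<Psi> \<circ> snd c) W"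
    by (rule inj_on_inverseI[of _ "\<lambda>x. chart_inv c (\<Psi>' x)"]) (use inv cinv in auto)
  have einv: "inv_into W (\<Psi> \<circ> snd c) ((\<Psi> \<circ> snd c) q) = q" if "q \<in> W" for q
    by (rule inv_into_f_f[OF inj that])
  have "continuous_on W (\<Psi> \<circ> snd c)"
    using is_chart_continuous(1)[OF c1] W P cont(1)
    by (intro continuous_on_compose) (auto intro: continuous_on_subset)
  moreover have "continuous_on ((\<Psi> \<circ> snd c) ` W) (inv_into W (\<Psi> \<circ> snd c))"
  proof (rule continuous_on_cong[THEN iffD1])
    show "continuous_on ((\<Psi> \<circ> snd c) ` W) (chart_inv c \<circ> \<Psi>')"
    proof (intro continuous_on_compose)
      show "continuous_on ((\<Psi> \<circ> snd c) ` W) \<Psi>'"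
        using \<Psi>(1) WP by (intro continuous_on_subset[OF cont(2)]) auto
      show "continuous_on (\<Psi>' ` (\<Psi> \<circ> snd c) ` W) (chart_inv c)"
        using inv W by (intro continuous_on_subset[OF is_chart_continuous(2)[OF c1]]) auto
    qed
  qed (use inv einv cinv in auto)
  ultimately have "is_chart e"
    unfolding is_chart_def homeomorphism_def e_def
    using W(1) inj op einv by (auto simp: image_iff)
  moreover have "analytic_compatible e d" if "d \<in> A" for d
    unfolding analytic_compatible_def
  proof (intro conjI allI)
    fix i
    have SP: "snd e ` (fst e \<inter> fst d) \<subseteq> P" using \<Psi>(1) WP by (auto simp: e_def)
    show "(\<lambda>x. transition e d x $ i) real_analytic_on snd e ` (fst e \<inter> fst d)"
    proof (rule real_analytic_on_cong)
      show "(\<lambda>x. transition c d (\<Psi>' x) $ i) real_analytic_on snd e ` (fst e \<inter> fst d)"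
      proof (rule real_analytic_on_compose[where h = "\<lambda>x. transition c d x $ i"])
        show "(\<lambda>x. transition c d x $ i) real_analytic_on snd c ` (fst c \<inter> fst d)"
          using comp[OF that] by (simp add: analytic_compatible_def)
        show "(\<lambda>x. \<Psi>' x $ i) real_analytic_on snd e ` (fst e \<inter> fst d)" for i
          by (rule real_analytic_on_subset[OF an(2) SP])
        show "\<Psi>' ` snd e ` (fst e \<inter> fst d) \<subseteq> snd c ` (fst c \<inter> fst d)"
          using inv W by (auto simp: e_def)
      qed
      show "transition c d (\<Psi>' x) $ i = transition e d x $ i" if "x \<in> snd e ` (fst e \<inter> fst d)" for x
        using that inv einv cinv by (auto simp: e_def transition_def)
    qed
    show "(\<lambda>x. transition d e x $ i) real_analytic_on snd d ` (fst e \<inter> fst d)" for i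
    proof (rule real_analytic_on_cong)
      show "(\<lambda>x. \<Psi> (transition d c x) $ i) real_analytic_on snd d ` (fst e \<inter> fst d)"
      proof (rule real_analytic_on_compose[OF an(1), where g = "transition d c"])
        have "(\<lambda>x. transition d c x $ i) real_analytic_on snd d ` (fst c \<inter> fst d)" for i
          using comp[OF that] by (simp add: analytic_compatible_def Int_commute)
        then show "(\<lambda>x. transition d c x $ i) real_analytic_on snd d ` (fst e \<inter> fst d)" for i
          by (rule real_analytic_on_subset) (use W in \<open>auto simp: e_def\<close>)
        have "is_chart d" using A \<open>d \<in> A\<close> by (auto simp: real_analytic_atlas_def)
        then show "transition d c ` snd d ` (fst e \<inter> fst d) \<subseteq> P"
          using WP chart_inv_coord by (fastforce simp: e_def transition_def)
      qed
    qed (simp add: e_def transition_def)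
  qed
  ultimately show "(W, \<Psi> \<circ> snd c) \<in> max_atlas A" by (simp add: max_atlas_def e_def)
qed

lemma real_analytic_on_coord: "(\<lambda>x. x $ i) real_analytic_on S"
  unfolding real_analytic_on_iff
proof
  fix x0 :: "real^'a" assume "x0 \<in> S"
  have "expands 1 (\<bar>x0 $ i\<bar> + 1) (\<lambda>y. x0 $ i + y $ i)"
    by (intro expands_add expands_const expands_coord) auto
  then show "\<exists>k r B. 0 < r \<and> expands r B (\<lambda>y. k (x0 + y)) \<and> (\<forall>x\<in>S. x - x0 \<in> cube r \<longrightarrow> k x = x $ i)"
    by (intro exI[of _ "\<lambda>x. x $ i"] exI[of _ 1] exI[of _ "\<bar>x0 $ i\<bar> + 1"]) simp
qed

text \<open>The sign of \<sigma> covers a shear and its inverse at once. The domain leaves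
  coordinate \<open>k\<close> free because \<phi> ignores it.\<close>

lemma real_analytic_on_shear:
  fixes x0 :: "real^'n"
  assumes r: "r > 0" and \<phi>: "expands r B \<phi>" and inv: "\<And>x t. \<phi> (replace_coord k t x) = \<phi> x"
  shows "(\<lambda>x. replace_coord k (x $ k + \<sigma> * (x0 $ k + \<phi> (x - x0))) x $ i)
    real_analytic_on {x. \<forall>i. i \<noteq> k \<longrightarrow> \<bar>x $ i - x0 $ i\<bar> < r}"
proof (cases "i = k")
  case False
  then show ?thesis using real_analytic_on_coord by (simp add: replace_coord_nth)
next
  case True
  have "(\<lambda>x. x $ k + \<sigma> * (x0 $ k + \<phi> (x - x0))) real_analytic_on {x. \<forall>i. i \<noteq> k \<longrightarrow> \<bar>x $ i - x0 $ i\<bar> < r}"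
    unfolding real_analytic_on_iff
  proof
    fix z assume z: "z \<in> {x. \<forall>i. i \<noteq> k \<longrightarrow> \<bar>x $ i - x0 $ i\<bar> < r}"
    show "\<exists>h s C. 0 < s \<and> expands s C (\<lambda>y. h (z + y)) \<and>
        (\<forall>x\<in>{x. \<forall>i. i \<noteq> k \<longrightarrow> \<bar>x $ i - x0 $ i\<bar> < r}. x - z \<in> cube s \<longrightarrow> h x = x $ k + \<sigma> * (x0 $ k + \<phi> (x - x0)))"
    proof -
      \<comment> \<open>Coordinate \<open>k\<close> of \<open>z - x0\<close> may be large; setting
        it to 0 leaves \<phi> unchanged and moves the centre into the cube where \<phi>
        expands.\<close>
      define w where "w = replace_coord k 0 (z - x0)"
      have w: "\<bar>w $ i\<bar> < r" for i using z r by (auto simp: w_def replace_coord_nth)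
      have "\<exists>r0>0. \<forall>s. 0 < s \<longrightarrow> s \<le> r0 \<longrightarrow> \<bar>w $ i\<bar> + s \<le> r" for i
        using w[of i] by (intro exI[of _ "r - \<bar>w $ i\<bar>"]) auto
      then obtain s where s: "s > 0" "\<And>i. \<bar>w $ i\<bar> + s \<le> r"
        using finite_uniform_radius[of "\<lambda>i s. \<bar>w $ i\<bar> + s \<le> r"] by metis
      have "\<phi> (w + y) = \<phi> (z + y - x0)" for y
      proof -
        have "w + y = replace_coord k (y $ k) (z + y - x0)"
          by (auto simp: w_def vec_eq_iff replace_coord_nth)
        then show ?thesis by (simp add: inv)
      qed
      moreover have "expands s B (\<lambda>y. \<phi> (w + y))"
        using s by (intro expands_shift[OF \<phi>]) auto
      ultimately have e: "expands s B (\<lambda>y. \<phi> (z + y - x0))" by simp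
      have "expands s (\<bar>z $ k\<bar> + s + \<bar>\<sigma>\<bar> * (\<bar>x0 $ k\<bar> + B))
          (\<lambda>y. z $ k + y $ k + \<sigma> * (x0 $ k + \<phi> (z + y - x0)))"
        using s(1) by (intro expands_add expands_scale expands_const expands_coord e) auto
      then show ?thesis using s(1)
        by (intro exI[of _ "\<lambda>x. x $ k + \<sigma> * (x0 $ k + \<phi> (x - x0))"] exI[of _ s]
            exI[of _ "\<bar>z $ k\<bar> + s + \<bar>\<sigma>\<bar> * (\<bar>x0 $ k\<bar> + B)"]) auto
    qed
  qed
  then show ?thesis using True by (simp add: replace_coord_nth)
qed

text \<open>Forgetting the coordinate \<open>k\<close> maps the hypersurface injectively into a hyperplane of the same
  dimension, so its image is open by invariance of domain.\<close>

lemma stratum_point_graph: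
  fixes A :: "('a::{t2_space, second_countable_topology}, 'n::finite) chart set"
    and c :: "('a, 'n) chart"
  assumes c: "is_chart c" and W: "open W" "W \<subseteq> fst c" and q: "q \<in> top_stratum A f" "q \<in> W"
    and inv: "\<And>x t. \<phi> (replace_coord k t x) = \<phi> x"
    and graph: "\<And>q'. q' \<in> W \<Longrightarrow> q' \<in> max_set f \<Longrightarrow> (snd c q' - x0) $ k = \<phi> (snd c q' - x0)"
  shows "eventually (\<lambda>y. \<exists>q'\<in>W \<inter> max_set f. replace_coord k (\<phi> y) y = snd c q' - x0) (nhds (snd c q - x0))"
proof -
  obtain W2 where qmax: "q \<in> max_set f" and W2: "open W2" "q \<in> W2"
    and emb: "embedded_analytic_hypersurface A W2 (W2 \<inter> max_set f)"
    using q(1) by (auto simp: top_stratum_def)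
  then obtain e j where e: "e \<in> max_atlas A" "q \<in> fst e" "fst e \<subseteq> W2" "open (chart_range e)"
    and slice: "snd e ` (fst e \<inter> (W2 \<inter> max_set f)) = {x \<in> chart_range e. x $ j = 0}"
    unfolding embedded_analytic_hypersurface_def by (meson IntI)
  have ce: "is_chart e" using e(1) by (simp add: max_atlas_def)
  have einv: "chart_inv e (snd e q) = q" if "q \<in> fst e" for q
    by (rule chart_inv_coord[OF ce that])
  define E where "E = fst e \<inter> W"
  have E: "open E" "E \<subseteq> fst e" using ce W by (auto simp: E_def is_chart_def)
  have opE: "open (snd e ` E)"
    using is_chart_open_image[OF ce E] e(4) openin_open_eq by blast
  \<comment> \<open>The part of the hyperplane slice that also lies over \<open>W\<close>; being cut
    out of an open set, it is open in the hyperplane.\<close>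
  define D where "D = {y \<in> snd e ` E. y $ j = 0}"
  have D_eq: "D = snd e ` (E \<inter> max_set f)"
  proof (intro equalityI subsetI)
    fix y assume "y \<in> D"
    then obtain q1 where q1: "q1 \<in> E" "y = snd e q1" "y $ j = 0" by (auto simp: D_def)
    then have "y \<in> snd e ` (fst e \<inter> (W2 \<inter> max_set f))" using E(2) by (auto simp: slice)
    then obtain q2 where "q2 \<in> fst e" "q2 \<in> max_set f" "y = snd e q2" by auto
    moreover have "q1 = q2" using einv q1 calculation E(2) by (metis subsetD)
    ultimately show "y \<in> snd e ` (E \<inter> max_set f)" using q1 by auto
  next
    fix y assume "y \<in> snd e ` (E \<inter> max_set f)"
    moreover have "snd e ` (E \<inter> max_set f) \<subseteq> {x \<in> chart_range e. x $ j = 0}"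
      unfolding slice[symmetric] using E(2) e(3) by auto
    ultimately show "y \<in> D" by (auto simp: D_def)
  qed
  define m where "m y = replace_coord k 0 (snd c (chart_inv e y) - x0)" for y
  have m_snd: "m (snd e q') = replace_coord k 0 (snd c q' - x0)" if "q' \<in> E" for q'
    using einv that E(2) by (auto simp: m_def)
  \<comment> \<open>A maximum in \<open>W\<close> lies on the graph, so its remaining coordinates
    determine it. This yields injectivity of \<open>m\<close> and, at the end, the required
    maxima.\<close>
  have recover: "replace_coord k (\<phi> y) y = snd c q' - x0"
    if "q' \<in> E \<inter> max_set f" "replace_coord k 0 y = replace_coord k 0 (snd c q' - x0)" for q' y
  proof -
    have "\<phi> y = \<phi> (snd c q' - x0)" using that(2) inv by metis
    then have "\<phi> y = (snd c q' - x0) $ k" using graph[of q'] that(1) by (auto simp: E_def)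
    then show ?thesis using that(2) replace_coord_replace replace_coord_self by metis
  qed
  have hyper: "subspace {y::real^'n. y $ i = 0}" "dim {y::real^'n. y $ i = 0} = CARD('n) - 1" for i
  proof -
    have "{y::real^'n. y $ i = 0} = {y. axis i 1 \<bullet> y = 0}" by (simp add: inner_axis')
    then show "subspace {y::real^'n. y $ i = 0}" "dim {y::real^'n. y $ i = 0} = CARD('n) - 1"
      by (simp_all add: subspace_hyperplane dim_hyperplane axis_eq_0_iff)
  qed
  have "openin (top_of_set {y. y $ k = 0}) (m ` D)"
  proof (rule invariance_of_domain_subspaces[of "{y. y $ j = 0}"])
    show "openin (top_of_set {y. y $ j = 0}) D"
      unfolding openin_open D_def by (rule exI[of _ "snd e ` E"]) (use opE in auto)
    show "continuous_on D m"
    proof -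
      have "chart_inv e ` D \<subseteq> fst c" unfolding D_eq using einv E(2) W(2) by (auto simp: E_def)
      moreover have "D \<subseteq> chart_range e" using E(2) by (auto simp: D_def)
      then have "continuous_on D (chart_inv e)"
        by (rule continuous_on_subset[OF is_chart_continuous(2)[OF ce]])
      ultimately have "continuous_on D (\<lambda>y. snd c (chart_inv e y))"
        by (intro continuous_on_compose2[OF is_chart_continuous(1)[OF c]])
      then show ?thesis
        unfolding m_def by (intro continuous_on_replace_coord continuous_intros)
    qed
    show "inj_on m D"
    proof (rule inj_onI)
      fix y1 y2 assume y: "y1 \<in> D" "y2 \<in> D" "m y1 = m y2"
      then obtain q1 q2 where q12: "q1 \<in> E \<inter> max_set f" "y1 = snd e q1" "q2 \<in> E \<inter> max_set f" "y2 = snd e q2"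
        by (auto simp: D_eq)
      then have eq: "replace_coord k 0 (snd c q1 - x0) = replace_coord k 0 (snd c q2 - x0)"
        using y(3) m_snd by auto
      have "snd c q1 - x0 = snd c q2 - x0"
        using recover[OF q12(3) eq] recover[OF q12(1) refl] by simp
      then have "snd c q1 = snd c q2" by simp
      moreover have "q1 \<in> fst c" "q2 \<in> fst c" using q12 W(2) by (auto simp: E_def)
      ultimately have "q1 = q2" using chart_inv_coord[OF c] by metis
      then show "y1 = y2" using q12 by simp
    qed
  qed (simp_all only: hyper order_refl, auto simp: m_def replace_coord_nth)
  then obtain T where T: "open T" "m ` D = {y. y $ k = 0} \<inter> T" by (auto simp: openin_open)
  have "q \<in> E \<inter> max_set f" using q e qmax by (simp add: E_def)
  then have "m (snd e q) \<in> m ` D" by (auto simp: D_eq)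
  then have y1: "replace_coord k 0 (snd c q - x0) \<in> T"
    using T(2) m_snd \<open>q \<in> E \<inter> max_set f\<close> by auto
  \<comment> \<open>The claim depends on \<open>y\<close> only through its other coordinates, so
    openness in the hyperplane thickens to a full neighbourhood, as the identity theorem
    demands.\<close>
  have "open (replace_coord k 0 -` T)"
    using T(1)
    by (intro open_vimage continuous_on_replace_coord continuous_on_id)
  then have "eventually (\<lambda>y. y \<in> replace_coord k 0 -` T) (nhds (snd c q - x0))"
    using y1 by (intro eventually_nhds_in_open) auto
  then show ?thesis
  proof eventually_elim
    case (elim y)
    then have "replace_coord k 0 y \<in> m ` D" unfolding T(2) by (simp add: replace_coord_nth)
    then obtain q' where q': "q' \<in> E \<inter> max_set f" "replace_coord k 0 y = m (snd e q')"
      by (auto simp: D_eq)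
    then have "replace_coord k 0 y = replace_coord k 0 (snd c q' - x0)" using m_snd by auto
    from recover[OF q'(1) this] show ?case using q'(1) by (auto simp: E_def)
  qed
qed

section \<open>The Hessian at a maximum and the conclusion\<close>

lemma max_set_eq:
  assumes "\<And>y. f y \<le> f xm"
  shows "max_set f = {x. f x = f xm}"
proof -
  have "(SUP y. f y) = f xm" using assms by (intro cSup_eq_maximum) auto
  then show ?thesis by (simp add: max_set_def)
qed

text \<open>At a critical point the Christoffel symbols multiply vanishing first derivatives,
  leaving the matrix of second coordinate derivatives.\<close>

lemma hessian_expansion:
  fixes c :: "('a, 'n::finite) chart"
  assumes F: "expansion R a (\<lambda>y. (f \<circ> chart_inv c) (snd c p + y))" and R: "R > 0"
    and S: "\<And>y. y \<in> cube R \<Longrightarrow> snd c p + y \<in> interior (chart_range c)"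
    and crit: "\<And>k. series_value (derivative_coeff k a) 0 = 0"
  shows "hessian g f c p $ i $ j = derivative_coeff i (derivative_coeff j a) (\<lambda>_. 0)"
proof -
  define D where "D k = partial_deriv (chart_range c) k" for k
  \<comment> \<open>The first derivative is identified on a whole cube, not just at
    \<open>p\<close>, so that it can be differentiated again.\<close>
  have D1: "D k (f \<circ> chart_inv c) (snd c p + y) = series_value (derivative_coeff k a) y"
    if "y \<in> cube (R / 2)" for k y
    unfolding D_def
  proof (rule partial_deriv_expansion[OF F _ S])
    show "\<bar>y $ i\<bar> < 3 * R / 4" for i
    proof -
      have "\<bar>y $ i\<bar> \<le> R / 2" using that by (simp add: cube_iff)
      then show ?thesis using R by simp
    qed
  qed (use R in auto)
  have "expansion (R / 2) (derivative_coeff j a) (series_value (derivative_coeff j a))"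
    using F R by (intro expansion_series_value derivative_coeff_summable[of a R]) (auto simp: expansion_def)
  then have "D i (D j (f \<circ> chart_inv c)) (snd c p + 0) = series_value (derivative_coeff i (derivative_coeff j a)) 0"
    unfolding D_def[of i]
  proof (rule partial_deriv_expansion[where r = "R / 4"])
    show "D j (f \<circ> chart_inv c) (snd c p + y) = series_value (derivative_coeff j a) y"
      if "y \<in> cube (R / 2)" for y by (rule D1[OF that])
    show "snd c p + y \<in> interior (chart_range c)" if "y \<in> cube (R / 2)" for y
      using S that cube_mono[of "R / 2" R] R by auto
  qed (use R in auto)
  moreover have "D k (f \<circ> chart_inv c) (snd c p) = 0" for k
    using D1[of 0 k] R crit[of k] by (simp add: cube_iff)
  ultimately show ?thesis by (simp add: hessian_def Let_def D_def series_value_0)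
qed

text \<open>In a chart \<open>f\<close> is continuous, so a value below the maximum at
  \<open>p\<close> would persist nearby and exclude stratum points.\<close>

lemma closure_top_stratum_subset_max_set:
  fixes A :: "('a::{t2_space, second_countable_topology}, 'n::finite) chart set"
  assumes A: "real_analytic_atlas A" and f: "real_analytic_function A f"
    and max: "\<And>y. f y \<le> f xm" and p: "p \<in> closure (top_stratum A f)"
  shows "f p = f xm"
proof (rule ccontr)
  assume "f p \<noteq> f xm"
  then have less: "f p < f xm" using max[of p] by simp
  obtain c where c: "c \<in> A" "p \<in> fst c" "is_chart c"
    using A by (fastforce simp: real_analytic_atlas_def)
  have "continuous_on (chart_range c) (f \<circ> chart_inv c)"
    using f c by (intro real_analytic_on_continuous_on) (auto simp: real_analytic_function_def)
  then have "continuous_on (fst c) ((f \<circ> chart_inv c) \<circ> snd c)"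
    by (intro continuous_on_compose[OF is_chart_continuous(1)[OF c(3)]])
  then have "continuous_on (fst c) f"
    by (rule continuous_on_cong[THEN iffD1, rotated 2]) (use chart_inv_coord[OF c(3)] in auto)
  then have "open (fst c \<inter> f -` {..< f xm})"
    by (rule continuous_open_preimage) (use c in \<open>auto simp: is_chart_def\<close>)
  then obtain q where "q \<in> top_stratum A f" "f q < f xm"
    using p c less closure_iff_nhds_not_empty[of p "top_stratum A f"] by blast
  then show False using max_set_eq[of f xm, OF max] by (auto simp: top_stratum_def)
qed

theorem theorem3p3:
  fixes A :: "('a::{t2_space, second_countable_topology}, 'n::finite) chart set"
    and g :: "('a, 'n) chart \<Rightarrow> 'a \<Rightarrow> real^'n^'n"
    and f :: "'a \<Rightarrow> real"
    and p :: 'a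
  assumes "CARD('n) \<ge> 2"
    and "real_analytic_atlas A"
    and "real_analytic_metric A g"
    and "real_analytic_function A f"
    and "\<exists>x. \<forall>y. f y \<le> f x"
    and "max_set f \<inter> manifold_boundary A = {}"
    and "p \<in> closure (top_stratum A f)"
    and "hessian_norm A g f p \<noteq> 0"
  shows "p \<in> top_stratum A f"
proof -
  note A = assms(2)
  obtain xm where xm: "\<And>y. f y \<le> f xm" using assms(5) by blast
  have "f p = f xm" by (rule closure_top_stratum_subset_max_set[OF A assms(4) xm assms(7)])
  then have max: "f y \<le> f p" for y using xm by simp
  have max_set: "max_set f = {x. f x = f p}" by (rule max_set_eq) (rule max)
  \<comment> \<open>The choice made inside \<open>hessian_norm\<close>, so that its nonvanishing
    gives a nonzero Hessian entry in this very chart.\<close>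
  define c where "c = (SOME c. c \<in> A \<and> p \<in> fst c)"
  have "\<exists>c. c \<in> A \<and> p \<in> fst c" using A by (fastforce simp: real_analytic_atlas_def)
  then have c: "c \<in> A" "p \<in> fst c" unfolding c_def by (metis (mono_tags, lifting) someI_ex)+
  have cc: "is_chart c" using A c by (simp add: real_analytic_atlas_def)
  obtain i j where hess: "hessian g f c p $ i $ j \<noteq> 0"
    using assms(8) unfolding hessian_norm_def Let_def c_def[symmetric] by fastforce
  define x0 where "x0 = snd c p"
  define F where "F = f \<circ> chart_inv c"
  have F_snd: "F (snd c q) = f q" if "q \<in> fst c" for q
    using chart_inv_coord[OF cc that] by (simp add: F_def)
  \<comment> \<open>\<open>chart_inv c\<close> is total, and whatever it returns off the chart
    range, \<open>f\<close> is at most \<open>f p\<close> there.\<close>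
  have F_le: "F x \<le> F x0" for x using max by (simp add: F_def x0_def chart_inv_coord[OF cc c(2)])
  have "p \<notin> manifold_boundary A" using assms(6) max_set by blast
  then have "x0 \<in> interior (chart_range c)" unfolding x0_def by (rule chart_interior[OF cc c])
  then obtain R1 where R1: "R1 > 0" "\<And>y. y \<in> cube R1 \<Longrightarrow> x0 + y \<in> interior (chart_range c)"
    by (rule open_contains_offset_cube[OF open_interior]) (rule that)
  have "F real_analytic_on chart_range c"
    using assms(4) c by (simp add: real_analytic_function_def F_def)
  moreover have "x0 \<in> chart_range c" using c by (simp add: x0_def)
  ultimately obtain h R0 B where R0: "R0 > 0" and h: "expands R0 B (\<lambda>y. h (x0 + y))"
    and hF: "\<And>x. x \<in> chart_range c \<Longrightarrow> x - x0 \<in> cube R0 \<Longrightarrow> h x = F x"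
    unfolding real_analytic_on_iff by blast
  \<comment> \<open>The extension \<open>h\<close> agrees with \<open>F\<close> only on the chart
    range; the second radius keeps the cube in its interior, so \<open>F\<close> itself
    expands.\<close>
  define R where "R = min R0 R1"
  have R: "R > 0" "R \<le> R0" "R \<le> R1" using R0 R1 by (auto simp: R_def)
  have int: "x0 + y \<in> interior (chart_range c)" if "y \<in> cube R" for y
    using R1(2) that cube_mono[OF R(3)] by blast
  obtain a where "expansion R0 a (\<lambda>y. h (x0 + y))" using h by (auto simp: expands_def)
  then have "expansion R a (\<lambda>y. h (x0 + y))" by (rule expansion_shrink) (use R in auto)
  then have a: "expansion R a (\<lambda>y. F (x0 + y))"
  proof (rule expansion_cong)
    fix y :: "real^'n" assume y: "y \<in> cube R"
    then show "h (x0 + y) = F (x0 + y)"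
      using hF[of "x0 + y"] int[OF y] cube_mono[OF R(2)] interior_subset by auto
  qed
  have "series_value (derivative_coeff k a) 0 = 0" for k
    by (rule expansion_gradient_at_max[OF a]) (use F_le R in auto)
  then have nz: "derivative_coeff i (derivative_coeff j a) (\<lambda>_. 0) \<noteq> 0"
    using hess hessian_expansion[of R a f c p g i j] a R(1) int by (simp add: x0_def F_def)
  have F_le0: "F (x0 + y) \<le> F (x0 + 0)" for y using F_le by simp
  obtain k \<phi> r where r: "0 < r" "r < R" and \<phi>: "expands r R \<phi>"
    and inv: "\<And>x t. \<phi> (replace_coord k t x) = \<phi> x"
    and graph: "\<And>x. x \<in> cube r \<Longrightarrow> F (x0 + x) = F (x0 + 0) \<Longrightarrow> x $ k = \<phi> x"
    by (rule maximum_set_in_graph[OF a R(1) F_le0 nz]) (rule that)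
  \<comment> \<open>The defect of \<open>f\<close> from its maximum along the graph; the height
    \<phi> ignores coordinate \<open>k\<close>, so \<open>u\<close> can be treated as a power series
    in all coordinates.\<close>
  define u where "u y = F (x0 + replace_coord k (\<phi> y) y) - F x0" for y
  have "expands r R (\<lambda>y. replace_coord k (\<phi> y) y $ i)" for i
    using \<phi> expands_mono[OF expands_coord[of r i], of R] r by (cases "i = k") (auto simp: replace_coord_nth)
  then have u: "expands r (series_norm R a + \<bar>F x0\<bar>) u"
    unfolding u_def using r
    by (intro expands_diff expands_const expands_compose[OF expansion_imp_expands[OF a]]) auto
  \<comment> \<open>The radius \<open>r / 4\<close> is the one to which vanishing of
    \<open>u\<close> propagates.\<close>
  define V where "V = {x. \<forall>i. \<bar>x $ i - x0 $ i\<bar> < r / 4}"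
  have V: "open V" unfolding V_def by (rule open_cube_around)
  have V_cube: "x - x0 \<in> cube (r / 4)" if "x \<in> V" for x
    using that by (auto simp: V_def cube_iff intro: less_imp_le)
  have V_range: "V \<subseteq> chart_range c"
  proof
    fix x assume "x \<in> V"
    then have "x0 + (x - x0) \<in> interior (chart_range c)"
      using V_cube cube_mono[of "r / 4" R] r by (intro int) auto
    then show "x \<in> chart_range c" using interior_subset by auto
  qed
  define W where "W = fst c \<inter> snd c -` V"
  have W: "open W" "W \<subseteq> fst c"
    using continuous_open_preimage[OF is_chart_continuous(1)[OF cc] _ V] cc
    by (auto simp: W_def is_chart_def)
  have snd_W: "snd c ` W = V" using V_range by (auto simp: W_def)
  have W_cube: "snd c q - x0 \<in> cube (r / 4)" if "q \<in> W" for q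
    using that V_cube by (auto simp: W_def)
  have pW: "p \<in> W" using c r by (simp add: W_def V_def x0_def)
  have W_graph: "(snd c q - x0) $ k = \<phi> (snd c q - x0)" if "q \<in> W" "q \<in> max_set f" for q
  proof (rule graph)
    show "snd c q - x0 \<in> cube r" using W_cube[OF that(1)] cube_mono[of "r / 4" r] r by auto
    show "F (x0 + (snd c q - x0)) = F (x0 + 0)"
      using that W(2) c max_set F_snd by (auto simp: x0_def)
  qed
  obtain q where q: "q \<in> top_stratum A f" "q \<in> W"
    using assms(7) pW W(1) closure_iff_nhds_not_empty[of p "top_stratum A f"] by blast
  have "eventually (\<lambda>y. \<exists>q'\<in>W \<inter> max_set f. replace_coord k (\<phi> y) y = snd c q' - x0)
      (nhds (snd c q - x0))"
    by (rule stratum_point_graph[OF cc W q inv]) (rule W_graph)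
  then have "eventually (\<lambda>y. u y = 0) (nhds (snd c q - x0))"
  proof eventually_elim
    case (elim y)
    then obtain q' where "q' \<in> W" "q' \<in> max_set f" "replace_coord k (\<phi> y) y = snd c q' - x0" by auto
    then show "u y = 0" using F_snd W(2) max_set c by (auto simp: u_def x0_def)
  qed
  moreover have "\<bar>(snd c q - x0) $ i\<bar> < r / 4" for i using q(2) by (simp add: W_def V_def)
  ultimately have u0: "u y = 0" if "y \<in> cube (r / 4)" for y
    using expands_vanishing_propagates[OF u r(1)] that by blast
  \<comment> \<open>Vanishing of \<open>u\<close> supplies the missing converse: every graph point
    in \<open>W\<close> is a maximum.\<close>
  have W_max: "q \<in> max_set f \<longleftrightarrow> (snd c q - x0) $ k = \<phi> (snd c q - x0)" if "q \<in> W" for q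
  proof
    assume "(snd c q - x0) $ k = \<phi> (snd c q - x0)"
    then have "replace_coord k (\<phi> (snd c q - x0)) (snd c q - x0) = snd c q - x0"
      by (metis replace_coord_self)
    then have "F (snd c q) = F x0" using u0[OF W_cube[OF that]] by (simp add: u_def)
    then show "q \<in> max_set f" using F_snd that W(2) c max_set by (auto simp: x0_def)
  qed (rule W_graph[OF that])
  \<comment> \<open>A cylinder unrestricted in coordinate \<open>k\<close>, hence mapped to itself
    by every shear \<open>\<Psi> \<sigma>\<close>. \<open>\<Psi> (- 1)\<close> lowers the graph to
    height 0 and \<open>\<Psi> 1\<close> undoes this.\<close>
  define P where "P = {x. \<forall>i. i \<noteq> k \<longrightarrow> \<bar>x $ i - x0 $ i\<bar> < r}"
  define \<Psi> where "\<Psi> \<sigma> x = replace_coord k (x $ k + \<sigma> * (x0 $ k + \<phi> (x - x0))) x" for \<sigma> x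
  have \<phi>_\<Psi>: "\<phi> (\<Psi> \<sigma> x - x0) = \<phi> (x - x0)" for \<sigma> x
  proof -
    have "\<Psi> \<sigma> x - x0 = replace_coord k ((\<Psi> \<sigma> x - x0) $ k) (x - x0)"
      by (simp add: \<Psi>_def vec_eq_iff replace_coord_nth)
    then show ?thesis by (metis inv)
  qed
  have \<Psi>_inv: "\<Psi> \<sigma> (\<Psi> (- \<sigma>) x) = x" for \<sigma> x
  proof -
    have "\<Psi> \<sigma> (\<Psi> (- \<sigma>) x) = replace_coord k (\<Psi> (- \<sigma>) x $ k + \<sigma> * (x0 $ k + \<phi> (x - x0))) (\<Psi> (- \<sigma>) x)"
      using \<phi>_\<Psi>[of "- \<sigma>" x] by (simp add: \<Psi>_def[of \<sigma>])
    then show ?thesis by (simp add: \<Psi>_def vec_eq_iff replace_coord_nth)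
  qed
  have \<Psi>_P: "\<Psi> \<sigma> x \<in> P" if "x \<in> P" for \<sigma> x using that by (simp add: P_def \<Psi>_def replace_coord_nth)
  have "P = (\<Inter>i\<in>UNIV - {k}. {x. \<bar>x $ i - x0 $ i\<bar> < r})" by (auto simp: P_def)
  moreover have "open {x::real^'n. \<bar>x $ i - x0 $ i\<bar> < r}" for i
    by (intro open_Collect_less continuous_intros)
  ultimately have P: "open P" by (simp add: open_INT)
  define e where "e = (W, \<Psi> (- 1) \<circ> snd c)"
  have VP: "snd c ` W \<subseteq> P"
  proof
    fix x assume "x \<in> snd c ` W"
    then have "\<bar>x $ i - x0 $ i\<bar> < r / 4" for i unfolding snd_W by (simp add: V_def)
    moreover have "r / 4 < r" using r by simp
    ultimately show "x \<in> P" unfolding P_def by (blast intro: order_less_trans)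
  qed
  have an: "(\<lambda>x. \<Psi> \<sigma> x $ i) real_analytic_on P" for \<sigma> i
    unfolding \<Psi>_def P_def by (rule real_analytic_on_shear[OF r(1) \<phi> inv])
  have e: "e \<in> max_atlas A" "open (chart_range e)"
    using recoordinatized_chart_in_max_atlas[where \<Psi> = "\<Psi> (- 1)" and \<Psi>' = "\<Psi> 1",
        OF A c(1) W P VP _ \<Psi>_P _ \<Psi>_P _ an an]
      \<Psi>_inv[of 1] \<Psi>_inv[of "- 1"] V snd_W by (auto simp: e_def)
  have e_k: "snd e q $ k = 0 \<longleftrightarrow> q \<in> max_set f" if "q \<in> W" for q
    unfolding W_max[OF that] by (auto simp: e_def \<Psi>_def replace_coord_nth)
  have "snd e ` (fst e \<inter> (W \<inter> max_set f)) = {x \<in> chart_range e. x $ k = 0}"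
    using e_k by (auto simp: e_def)
  \<comment> \<open>The domain of \<open>e\<close> is all of \<open>W\<close>, so this single chart
    serves every point of the hypersurface.\<close>
  then have "embedded_analytic_hypersurface A W (W \<inter> max_set f)"
    unfolding embedded_analytic_hypersurface_def
    by (intro conjI ballI bexI[OF _ e(1)]) (use e(2) in \<open>auto simp: e_def\<close>)
  then show ?thesis using W(1) pW max_set by (auto simp: top_stratum_def)
qed

end
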